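(* Let $k_0\ge 0$ be a fixed integer. For a finite abstract simplicial complex $S$ with $s_0$ $0$-simplices and whose largest simplices are $K$-simplices, the reduction algorithm (defined in the context) applied to $S$ and a list of critical $0$-simplices has a complexity upper bounded, as $s_0\to\infty$, by $$O\Big(s_0^{3k_0+7}+s_0^{k_0+3}\sum_{k=k_0+2}^{K}\binom{s_0}{k+1}\Big).$$
   Context: A finite abstract simplicial complex $S$ is a finite collection of nonempty finite sets (simplices) closed under taking nonempty subsets; a $k$-simplex is a simplex with $k+1$ vertices. If a simplex $\sigma$ is contained in a simplex $\tau$, then $\tau$ is a coface of $\sigma$; a $k$-coface is a coface that is a $k$-simplex. $\beta_k(S)$ is the dimension of the $k$-th simplicial homology $H_k(S)$ with coefficients in a field. For a simplex $\sigma$ of $S$, its degree is $D(\sigma)=\max\{d : \sigma\subset\tau \text{ for some } d\text{-simplex }\tau \text{ of } S\}$. For a $0$-simplex $x$, its index is $I(x)=\min\{D(\sigma) : \sigma \text{ a } (k_0+1)\text{-simplex of } S \text{ containing } x\}$, and $I(x)=0$ if $x$ has no $(k_0+1)$-coface. Reduction algorithm. Input: complex $S$, list $L$ of critical $0$-simplices, integer $k_0$. Compute $\beta_0(S),\dots,\beta_{k_0}(S)$, the degrees of all $(k_0+1)$-simplices, and the indices of all $0$-simplices; then set $I(x)=-1$ for every $x\in L$. Let $I_{\max}$ denote the maximum of the current indices. While $I_{\max}>k_0+1$: draw uniformly at random a $0$-simplex $\hat x$ with $I(\hat x)=I_{\max}$; let $S'$ be $S$ with $\hat x$ and all its cofaces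 removed; compute $\beta_0(S'),\dots,\beta_{k_0}(S')$. If $\beta_k(S')\ne\beta_k(S)$ for some $k\in\{0,\dots,k_0\}$, cancel the removal (keep $S$) and flag $\hat x$ as critical by setting $I(\hat x)=-1$. Otherwise, replace $S$ by $S'$, recompute the degrees of the $(k_0+1)$-simplices and the indices of all $0$-simplices whose current index is not $-1$. Update $I_{\max}$. When the loop ends, output the final complex $S$. Complexity means worst-case number of elementary operations. The complex is given by the list of all its simplices; field operations and inclusion tests between simplices have unit cost; Betti numbers are computed from the ranks of the boundary matrices, and the rank of an $n\times m$ matrix costs $O(nm\min(n,m))$. *)

theory Defs
  imports "HOL-Probability.Probability" "HOL-Library.Monad_Syntax"
    "HOL-Algebra.AbelCoset" "Jordan_Normal_Form.DL_Rank"
begin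

section \<open>Simplicial complexes, homology, degrees and indices\<close>

definition abstract_simplicial_complex :: "'a set set \<Rightarrow> bool" where
  "abstract_simplicial_complex S \<longleftrightarrow> finite S \<and>
     (\<forall>\<sigma>\<in>S. finite \<sigma> \<and> \<sigma> \<noteq> {} \<and> (\<forall>\<tau>. \<tau> \<subseteq> \<sigma> \<and> \<tau> \<noteq> {} \<longrightarrow> \<tau> \<in> S))"

definition simplices :: "'a set set \<Rightarrow> nat \<Rightarrow> 'a set set" where
  "simplices S k = {\<sigma> \<in> S. card \<sigma> = k + 1}"

text \<open>Vertices are linearly ordered; each simplex is oriented by this order.\<close>

definition chain_space :: "'f::field itself \<Rightarrow> 'a set set \<Rightarrow> nat \<Rightarrow> ('f, 'a set \<Rightarrow> 'f) module" where
  "chain_space F S k = ring.func_space class_ring (simplices S k)"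

definition incidence :: "'a::linorder set \<Rightarrow> 'a set \<Rightarrow> 'f::field" where
  "incidence \<sigma> \<tau> = (\<Sum>v | v \<in> \<tau> \<and> \<sigma> = \<tau> - {v}. (- 1) ^ card {w \<in> \<tau>. w < v})"

text \<open>\<open>boundary_map S k\<close> is the boundary operator from \<open>(k+1)\<close>-chains to \<open>k\<close>-chains.\<close>

definition boundary_map :: "'a::linorder set set \<Rightarrow> nat \<Rightarrow> ('a set \<Rightarrow> 'f::field) \<Rightarrow> ('a set \<Rightarrow> 'f)" where
  "boundary_map S k c = (\<lambda>\<sigma>\<in>simplices S k. \<Sum>\<tau>\<in>simplices S (k + 1). incidence \<sigma> \<tau> * c \<tau>)"

definition cycle_space :: "'f::field itself \<Rightarrow> 'a::linorder set set \<Rightarrow> nat \<Rightarrow> ('a set \<Rightarrow> 'f) set" where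
  "cycle_space F S k = {c \<in> carrier (chain_space F S k).
     case k of 0 \<Rightarrow> True | Suc j \<Rightarrow> boundary_map S j c = \<zero>\<^bsub>chain_space F S j\<^esub>}"

definition boundary_space :: "'f::field itself \<Rightarrow> 'a::linorder set set \<Rightarrow> nat \<Rightarrow> ('a set \<Rightarrow> 'f) set" where
  "boundary_space F S k = boundary_map S k ` carrier (chain_space F S (k + 1))"

text \<open>The quotient of a vector space by a subspace, on the set of cosets. The fields \<open>mult\<close> and
  \<open>one\<close> of the record type play no role in modules.\<close>

definition quotient_space :: "('f, 'v) module \<Rightarrow> 'v set \<Rightarrow> ('f, 'v set) module" where
  "quotient_space V B =
     \<lparr>carrier = a_rcosets\<^bsub>V\<^esub> B, mult = undefined, one = undefined, zero = B,
      add = (\<lambda>X Y. X <+>\<^bsub>V\<^esub> Y), smult = (\<lambda>a X. \<Union>x\<in>X. B +>\<^bsub>V\<^esub> (a \<odot>\<^bsub>V\<^esub> x))\<rparr>"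

definition homology :: "'f::field itself \<Rightarrow> 'a::linorder set set \<Rightarrow> nat \<Rightarrow> ('f, ('a set \<Rightarrow> 'f) set) module" where
  "homology F S k = quotient_space ((chain_space F S k)\<lparr>carrier := cycle_space F S k\<rparr>) (boundary_space F S k)"

definition betti :: "'f::field itself \<Rightarrow> 'a::linorder set set \<Rightarrow> nat \<Rightarrow> nat" where
  "betti F S k = vectorspace.dim class_ring (homology F S k)"

definition simplex_degree :: "'a set set \<Rightarrow> 'a set \<Rightarrow> nat" where
  "simplex_degree S \<sigma> = Max {d. \<exists>\<tau>\<in>simplices S d. \<sigma> \<subseteq> \<tau>}"

text \<open>In the index, and in the algorithm below, a \<open>0\<close>-simplex is a singleton \<open>x\<close>.\<close>

definition vertex_index :: "'a set set \<Rightarrow> nat \<Rightarrow> 'a set \<Rightarrow> nat" where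
  "vertex_index S k0 x = (let C = {\<sigma> \<in> simplices S (k0 + 1). x \<subseteq> \<sigma>} in
     if C = {} then 0 else Min (simplex_degree S ` C))"

section \<open>Counting elementary operations\<close>

type_synonym 'b timed = "'b \<times> nat"

definition ret :: "'b \<Rightarrow> 'b timed" where
  "ret x = (x, 0)"

definition tick :: "'b \<Rightarrow> 'b timed" where
  "tick x = (x, 1)"

definition bind_timed :: "'b timed \<Rightarrow> ('b \<Rightarrow> 'c timed) \<Rightarrow> 'c timed" where
  "bind_timed m f = (let (x, t) = m; (y, u) = f x in (y, t + u))"

adhoc_overloading Monad_Syntax.bind \<rightleftharpoons> bind_timed

text \<open>Traversing a list costs one operation per cell, in addition to the cost of processing
  its elements.\<close>

fun map_timed :: "('b \<Rightarrow> 'c timed) \<Rightarrow> 'b list \<Rightarrow> 'c list timed" where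
  "map_timed f [] = tick []"
| "map_timed f (x # xs) = do { y \<leftarrow> f x; ys \<leftarrow> map_timed f xs; tick (y # ys) }"

fun filter_timed :: "('b \<Rightarrow> bool timed) \<Rightarrow> 'b list \<Rightarrow> 'b list timed" where
  "filter_timed p [] = tick []"
| "filter_timed p (x # xs) =
     do { b \<leftarrow> p x; ys \<leftarrow> filter_timed p xs; tick (if b then x # ys else ys) }"

fun fold_timed :: "('b \<Rightarrow> 'c \<Rightarrow> 'c timed) \<Rightarrow> 'b list \<Rightarrow> 'c \<Rightarrow> 'c timed" where
  "fold_timed f [] a = tick a"
| "fold_timed f (x # xs) a = do { a' \<leftarrow> f x a; r \<leftarrow> fold_timed f xs a'; tick r }"

definition length_timed :: "'b list \<Rightarrow> nat timed" where
  "length_timed xs = fold_timed (\<lambda>_ n. tick (n + 1)) xs 0"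

text \<open>Inclusion tests, equality tests and reading the dimension have unit cost. The vertices
  of a simplex are stored in increasing order.\<close>

definition subset_timed :: "'a set \<Rightarrow> 'a set \<Rightarrow> bool timed" where
  "subset_timed \<sigma> \<tau> = tick (\<sigma> \<subseteq> \<tau>)"

definition has_dim_timed :: "nat \<Rightarrow> 'a set \<Rightarrow> bool timed" where
  "has_dim_timed k \<sigma> = tick (card \<sigma> = k + 1)"

section \<open>The reduction algorithm\<close>

fun sign_timed :: "'a set \<Rightarrow> 'a list \<Rightarrow> 'f::field \<Rightarrow> 'f timed" where
  "sign_timed \<sigma> [] s = tick 0"
| "sign_timed \<sigma> (v # vs) s = do {
     b \<leftarrow> tick (v \<in> \<sigma>);
     if b then do { s' \<leftarrow> tick (- s); sign_timed \<sigma> vs s' } else ret s }"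

definition incidence_timed :: "'a::linorder set \<Rightarrow> 'a set \<Rightarrow> 'f::field timed" where
  "incidence_timed \<sigma> \<tau> = do {
     b \<leftarrow> subset_timed \<sigma> \<tau>;
     if b then sign_timed \<sigma> (sorted_list_of_set \<tau>) 1 else tick 0 }"

definition boundary_matrix_timed :: "'a::linorder set list \<Rightarrow> nat \<Rightarrow> 'f::field mat timed" where
  "boundary_matrix_timed S k = do {
     R \<leftarrow> filter_timed (has_dim_timed k) S;
     C \<leftarrow> filter_timed (has_dim_timed (k + 1)) S;
     n \<leftarrow> length_timed R;
     cs \<leftarrow> map_timed (\<lambda>\<tau>. map_timed (\<lambda>\<sigma>. incidence_timed \<sigma> \<tau>) R) C;
     tick (mat_of_cols_list n cs) }"

text \<open>\<open>rc A\<close> is the number of operations spent on computing the rank of the matrix \<open>A\<close>.\<close>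

definition rank_timed :: "('f::field mat \<Rightarrow> nat) \<Rightarrow> 'f mat \<Rightarrow> nat timed" where
  "rank_timed rc A = (vec_space.rank (dim_row A) A, rc A)"

definition boundary_rank_timed :: "('f::field mat \<Rightarrow> nat) \<Rightarrow> 'a::linorder set list \<Rightarrow> nat \<Rightarrow> nat timed" where
  "boundary_rank_timed rc S k = do { A \<leftarrow> boundary_matrix_timed S k; rank_timed rc A }"

definition betti_timed :: "('f::field mat \<Rightarrow> nat) \<Rightarrow> 'a::linorder set list \<Rightarrow> nat \<Rightarrow> nat timed" where
  "betti_timed rc S k = do {
     C \<leftarrow> filter_timed (has_dim_timed k) S;
     n \<leftarrow> length_timed C;
     r \<leftarrow> (case k of 0 \<Rightarrow> tick 0 | Suc j \<Rightarrow> boundary_rank_timed rc S j);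
     r' \<leftarrow> boundary_rank_timed rc S k;
     tick (n - r - r') }"

definition betti_list_timed :: "('f::field mat \<Rightarrow> nat) \<Rightarrow> nat \<Rightarrow> 'a::linorder set list \<Rightarrow> nat list timed" where
  "betti_list_timed rc k0 S = map_timed (betti_timed rc S) [0..<k0 + 1]"

definition degree_timed :: "'a set list \<Rightarrow> 'a set \<Rightarrow> nat timed" where
  "degree_timed S \<sigma> = fold_timed (\<lambda>\<tau> d. do {
     b \<leftarrow> subset_timed \<sigma> \<tau>;
     if b then tick (max d (card \<tau> - 1)) else ret d }) S 0"

definition degrees_timed :: "nat \<Rightarrow> 'a set list \<Rightarrow> ('a set \<times> nat) list timed" where
  "degrees_timed k0 S = do {
     C \<leftarrow> filter_timed (has_dim_timed (k0 + 1)) S;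
     map_timed (\<lambda>\<sigma>. do { d \<leftarrow> degree_timed S \<sigma>; tick (\<sigma>, d) }) C }"

definition index_timed :: "('a set \<times> nat) list \<Rightarrow> 'a set \<Rightarrow> nat timed" where
  "index_timed D x = do {
     Dx \<leftarrow> filter_timed (\<lambda>(\<sigma>, d). subset_timed x \<sigma>) D;
     case Dx of [] \<Rightarrow> tick 0
     | (\<sigma>, d) # D' \<Rightarrow> fold_timed (\<lambda>(\<sigma>', d') m. tick (min m d')) D' d }"

text \<open>The current indices are kept in a table that lists the \<open>0\<close>-simplices of the current complex
  with their indices.\<close>

definition flag_timed :: "'a set \<Rightarrow> ('a set \<times> int) list \<Rightarrow> ('a set \<times> int) list timed" where
  "flag_timed x I = map_timed (\<lambda>(y, i). do { b \<leftarrow> tick (y = x); tick (y, if b then - 1 else i) }) I"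

definition max_index_timed :: "('a set \<times> int) list \<Rightarrow> int timed" where
  "max_index_timed I = fold_timed (\<lambda>(y, i) m. tick (max m i)) I (- 1)"

definition init_timed ::
  "('f::field mat \<Rightarrow> nat) \<Rightarrow> nat \<Rightarrow> 'a::linorder set list \<Rightarrow> 'a set list \<Rightarrow> (nat list \<times> ('a set \<times> int) list) timed" where
  "init_timed rc k0 S L = do {
     b \<leftarrow> betti_list_timed rc k0 S;
     D \<leftarrow> degrees_timed k0 S;
     V \<leftarrow> filter_timed (has_dim_timed 0) S;
     I \<leftarrow> map_timed (\<lambda>x. do { i \<leftarrow> index_timed D x; tick (x, int i) }) V;
     I' \<leftarrow> fold_timed flag_timed L I;
     tick (b, I') }"

text \<open>One passage through the loop, with \<open>x\<close> the drawn \<open>0\<close>-simplex and \<open>b\<close> the list of Betti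
  numbers of the current complex \<open>S\<close>. A complex \<open>S'\<close> that replaces \<open>S\<close> has the same list \<open>b\<close>.\<close>

definition step_timed ::
  "('f::field mat \<Rightarrow> nat) \<Rightarrow> nat \<Rightarrow> nat list \<Rightarrow> 'a::linorder set list \<Rightarrow> ('a set \<times> int) list \<Rightarrow> 'a set
     \<Rightarrow> ('a set list \<times> ('a set \<times> int) list) timed" where
  "step_timed rc k0 b S I x = do {
     S' \<leftarrow> filter_timed (\<lambda>\<sigma>. do { c \<leftarrow> subset_timed x \<sigma>; tick (\<not> c) }) S;
     b' \<leftarrow> betti_list_timed rc k0 S';
     changed \<leftarrow> fold_timed (\<lambda>(u, v) e. tick (e \<or> u \<noteq> v)) (zip b b') False;
     if changed then do {
       I' \<leftarrow> flag_timed x I;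
       tick (S, I') }
     else do {
       D \<leftarrow> degrees_timed k0 S';
       J \<leftarrow> filter_timed (\<lambda>(y, i). tick (y \<noteq> x)) I;
       I' \<leftarrow> map_timed (\<lambda>(y, i). do {
              f \<leftarrow> tick (i = - 1);
              if f then tick (y, i) else do { j \<leftarrow> index_timed D y; tick (y, int j) } }) J;
       tick (S', I') } }"

lemma fst_tick [simp]: "fst (tick x) = x"
  by (simp add: tick_def)

lemma fst_ret [simp]: "fst (ret x) = x"
  by (simp add: ret_def)

lemma fst_bind_timed [simp]: "fst (bind_timed m f) = fst (f (fst m))"
  by (simp add: bind_timed_def split: prod.splits)

lemma fst_map_timed [simp]: "fst (map_timed f xs) = map (\<lambda>x. fst (f x)) xs"
  by (induction xs) auto

lemma fst_filter_timed [simp]: "fst (filter_timed p xs) = filter (\<lambda>x. fst (p x)) xs"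
  by (induction xs) auto

lemma fst_fold_timed [simp]: "fst (fold_timed f xs a) = fold (\<lambda>x a. fst (f x a)) xs a"
  by (induction xs arbitrary: a) auto

lemma fst_length_timed [simp]: "fst (length_timed xs) = length xs"
proof -
  have "fst (fold_timed (\<lambda>_ n. tick (n + 1)) xs m) = length xs + m" for m
    by (induction xs arbitrary: m) auto
  then show ?thesis by (simp add: length_timed_def)
qed

lemma fst_subset_timed [simp]: "fst (subset_timed \<sigma> \<tau>) = (\<sigma> \<subseteq> \<tau>)"
  by (simp add: subset_timed_def)

lemma fst_has_dim_timed [simp]: "fst (has_dim_timed k \<sigma>) = (card \<sigma> = k + 1)"
  by (simp add: has_dim_timed_def)

lemma fst_flag_timed:
  "fst (flag_timed x I) = map (\<lambda>(y, i). (y, if y = x then - 1 else i)) I"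
  by (auto simp: flag_timed_def)

lemma fst_max_index_timed:
  "fst (max_index_timed I) = Max (insert (- 1) (snd ` set I))"
proof -
  have *: "Max (insert (max i m) A) = Max (insert i (insert m A))" if "finite A" for i m :: int and A
    using that by (cases "A = {}") (simp_all add: max.assoc)
  have "fold (\<lambda>x m. fst ((\<lambda>(y, i) m. tick (max m i)) x m)) I m
      = Max (insert m (snd ` set I))" for m :: int
  proof (induction I arbitrary: m)
    case (Cons p I)
    then show ?case
      by (cases p) (simp add: * max.commute[of m] insert_commute[of m] del: Max_insert)
  qed simp
  then show ?thesis by (simp add: max_index_timed_def)
qed

lemma length_filter_map_less:
  assumes "\<And>p. p \<in> set I \<Longrightarrow> P (g p) \<Longrightarrow> P p" and "p \<in> set I" "P p" "\<not> P (g p)"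
  shows "length (filter P (map g I)) < length (filter P I)"
proof -
  have "filter (P \<circ> g) I = filter (P \<circ> g) (filter P I)"
    using assms(1) by (auto simp: filter_filter intro!: filter_cong)
  then have "length (filter P (map g I)) = length (filter (P \<circ> g) (filter P I))"
    by (simp add: filter_map)
  also have "\<dots> < length (filter P I)"
    using assms(2-4) by (intro length_filter_less) auto
  finally show ?thesis .
qed

lemma snd_fst_step_timed:
  "\<exists>c D. snd (fst (step_timed rc k0 b S I x)) =
     (if c then map (\<lambda>(y, i). (y, if y = x then - 1 else i)) I
      else map (\<lambda>(y, i). (y, if i = - 1 then i else int (fst (index_timed D y))))
             (filter (\<lambda>(y, i). y \<noteq> x) I))"
proof -
  have *: "fst (case p of (y, i) \<Rightarrow> do {
              f \<leftarrow> tick (i = - 1);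
              if f then tick (y, i) else do { j \<leftarrow> index_timed D y; tick (y, int j) } })
     = (case p of (y, i) \<Rightarrow> (y, if i = - 1 then i else int (fst (index_timed D y))))"
    for p :: "'a set \<times> int" and D
    by (cases p) simp
  have **: "fst (case p of (y, i) \<Rightarrow> tick (y \<noteq> x)) = (case p of (y, i) \<Rightarrow> y \<noteq> x)"
    for p :: "'a set \<times> int"
    by (cases p) simp
  show ?thesis
    unfolding step_timed_def fst_bind_timed fst_map_timed fst_filter_timed
      if_distrib[of fst] fst_flag_timed fst_tick if_distrib[of snd] snd_conv * **
    by blast
qed

lemma step_timed_decreasing:
  assumes "(x, i) \<in> set I" "i \<noteq> - 1"
  shows "length (filter (\<lambda>(y, i). i \<noteq> - 1) (snd (fst (step_timed rc k0 b S I x))))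
    < length (filter (\<lambda>(y, i). i \<noteq> - 1) I)"
proof -
  let ?P = "\<lambda>(y, i). i \<noteq> - 1"
  obtain c D where "snd (fst (step_timed rc k0 b S I x)) =
     (if c then map (\<lambda>(y, i). (y, if y = x then - 1 else i)) I
      else map (\<lambda>(y, i). (y, if i = - 1 then i else int (fst (index_timed D y))))
             (filter (\<lambda>(y, i). y \<noteq> x) I))"
    using snd_fst_step_timed[of rc k0 b S I x] by blast
  moreover have "length (filter ?P (map (\<lambda>(y, i). (y, if y = x then - 1 else i)) I))
      < length (filter ?P I)"
    by (rule length_filter_map_less[where p = "(x, i)"]) (use assms in \<open>auto split: if_splits\<close>)
  moreover have "length (filter ?P (map (\<lambda>(y, i). (y, if i = - 1 then i else int (fst (index_timed D y))))
        (filter (\<lambda>(y, i). y \<noteq> x) I))) < length (filter ?P I)"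
  proof -
    have "?P \<circ> (\<lambda>(y, i). (y, if i = - 1 then i else int (fst (index_timed D y)))) = ?P"
      by (auto simp: fun_eq_iff)
    then have "length (filter ?P (map (\<lambda>(y, i). (y, if i = - 1 then i else int (fst (index_timed D y))))
        (filter (\<lambda>(y, i). y \<noteq> x) I))) = length (filter ?P (filter (\<lambda>(y, i). y \<noteq> x) I))"
      by (simp add: filter_map)
    also have "\<dots> = length (filter (\<lambda>(y, i). y \<noteq> x) (filter ?P I))"
      by (simp add: filter_filter conj_commute case_prod_unfold)
    also have "\<dots> < length (filter ?P I)"
      using assms by (intro length_filter_less[where x = "(x, i)"]) auto
    finally show ?thesis .
  qed
  ultimately show ?thesis
    by simp
qed

text \<open>The argument \<open>b\<close> is the list of Betti numbers of the current complex \<open>S\<close>, \<open>I\<close> is the table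
  of current indices. Testing the loop condition and drawing the \<open>0\<close>-simplex cost one
  operation each.\<close>

function reduction_loop ::
  "('f::field mat \<Rightarrow> nat) \<Rightarrow> nat \<Rightarrow> nat list \<Rightarrow> 'a::linorder set list \<Rightarrow> ('a set \<times> int) list
     \<Rightarrow> 'a set list timed pmf" where
  "reduction_loop rc k0 b S I =
     (case max_index_timed I of (imax, t) \<Rightarrow>
      if imax \<le> int (k0 + 1) then return_pmf (S, t + 1)
      else case filter_timed (\<lambda>(y, i). tick (i = imax)) I of (X, t') \<Rightarrow>
        bind_pmf (pmf_of_set (fst ` set X)) (\<lambda>x.
          case step_timed rc k0 b S I x of ((S', I'), t'') \<Rightarrow>
            map_pmf (\<lambda>(out, u). (out, t + 1 + t' + 1 + t'' + u)) (reduction_loop rc k0 b S' I')))"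
  by pat_completeness auto
termination
proof (relation "inv_image less_than (\<lambda>(rc, k0, b, S, I). length (filter (\<lambda>(y, i). i \<noteq> - 1) I))",
    goal_cases)
  case (2 rc k0 b S I imax t X t' x SI t'' S' I')
  have imax: "imax = Max (insert (- 1) (snd ` set I))"
    using 2(1) fst_max_index_timed[of I] by (metis fst_conv)
  have "X = fst (filter_timed (\<lambda>(y, i). tick (i = imax)) I)"
    using 2(3) by (metis fst_conv)
  then have X: "X = filter (\<lambda>(y, i). i = imax) I"
    by (auto simp: case_prod_unfold)
  have "imax \<in> insert (- 1) (snd ` set I)"
    unfolding imax by (intro Max_in) auto
  moreover have imax': "imax \<noteq> - 1"
    using 2(2) by auto
  ultimately obtain y where "(y, imax) \<in> set I"
    by auto
  then have "(y, imax) \<in> set X"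
    unfolding X by simp
  then have "fst ` set X \<noteq> {}"
    by auto
  then have "x \<in> fst ` set X"
    using 2(4) by simp
  then have "(x, imax) \<in> set I"
    by (auto simp: X)
  moreover have "I' = snd (fst (step_timed rc k0 b S I x))"
    using 2(5,6) by (metis fst_conv snd_conv)
  ultimately show ?case
    using step_timed_decreasing[OF _ imax', of x I rc k0 b S] by simp
qed simp

definition reduction ::
  "('f::field mat \<Rightarrow> nat) \<Rightarrow> nat \<Rightarrow> 'a::linorder set list \<Rightarrow> 'a set list \<Rightarrow> 'a set list timed pmf" where
  "reduction rc k0 S L =
     (case init_timed rc k0 S L of ((b, I), t) \<Rightarrow>
        map_pmf (\<lambda>(out, u). (out, t + u)) (reduction_loop rc k0 b S I))"

section \<open>The computed values are the Betti numbers, degrees and indices\<close>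

lemma finite_simplices: "abstract_simplicial_complex S \<Longrightarrow> finite (simplices S k)"
  by (simp add: abstract_simplicial_complex_def simplices_def)

lemma simplicial_complex_card:
  assumes "abstract_simplicial_complex S" "\<sigma> \<in> S"
  shows "card \<sigma> \<ge> 1"
  using assms by (auto simp: abstract_simplicial_complex_def Suc_le_eq card_gt_0_iff)

lemma simplices_filter: "set (filter (\<lambda>\<sigma>. card \<sigma> = k + 1) S) = simplices (set S) k"
  by (auto simp: simplices_def)

lemma fst_degree_timed:
  assumes "abstract_simplicial_complex (set S)" "\<sigma> \<in> set S"
  shows "fst (degree_timed S \<sigma>) = simplex_degree (set S) \<sigma>"
proof -
  let ?f = "\<lambda>\<tau> d. fst (do { b \<leftarrow> subset_timed \<sigma> \<tau>;
     if b then tick (max d (card \<tau> - 1)) else ret d })"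
  have *: "fold ?f xs m = Max (insert m ((\<lambda>\<tau>. card \<tau> - 1) ` {\<tau> \<in> set xs. \<sigma> \<subseteq> \<tau>}))" for xs m
  proof (induction xs arbitrary: m)
    case (Cons \<tau> xs)
    define A where "A = (\<lambda>\<tau>. card \<tau> - 1) ` {\<tau> \<in> set xs. \<sigma> \<subseteq> \<tau>}"
    have A: "(\<lambda>\<tau>. card \<tau> - 1) ` {\<tau>' \<in> set (\<tau> # xs). \<sigma> \<subseteq> \<tau>'}
        = (if \<sigma> \<subseteq> \<tau> then insert (card \<tau> - 1) A else A)"
      by (auto simp: A_def)
    have "finite A" by (simp add: A_def)
    then have "Max (insert (max m i) A) = Max (insert m (insert i A))" for i
      by (cases "A = {}") (simp_all add: max.assoc)
    then show ?case
      unfolding A using Cons[folded A_def] by (simp del: Max_insert)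
  qed simp
  let ?D = "(\<lambda>\<tau>. card \<tau> - 1) ` {\<tau> \<in> set S. \<sigma> \<subseteq> \<tau>}"
  have "{d. \<exists>\<tau>\<in>simplices (set S) d. \<sigma> \<subseteq> \<tau>} = ?D"
    using simplicial_complex_card[OF assms(1)] by (force simp: simplices_def image_iff)
  moreover have "?D \<noteq> {}" "finite ?D"
    using assms(2) by auto
  moreover have "fst (degree_timed S \<sigma>) = Max (insert 0 ?D)"
    unfolding degree_timed_def fst_fold_timed by (rule *)
  ultimately show ?thesis
    by (simp add: simplex_degree_def)
qed

lemma fst_degrees_timed:
  assumes "abstract_simplicial_complex (set S)"
  shows "fst (degrees_timed k0 S)
    = map (\<lambda>\<sigma>. (\<sigma>, simplex_degree (set S) \<sigma>)) (filter (\<lambda>\<sigma>. card \<sigma> = k0 + 2) S)"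
  using fst_degree_timed[OF assms] by (auto simp: degrees_timed_def)

lemma fst_index_timed:
  assumes "abstract_simplicial_complex (set S)"
  shows "fst (index_timed (fst (degrees_timed k0 S)) x) = vertex_index (set S) k0 x"
proof -
  let ?C = "filter (\<lambda>\<sigma>. x \<subseteq> \<sigma>) (filter (\<lambda>\<sigma>. card \<sigma> = k0 + 2) S)"
  have set_C: "set ?C = {\<sigma> \<in> simplices (set S) (k0 + 1). x \<subseteq> \<sigma>}"
    by (auto simp: simplices_def)
  have *: "fold (\<lambda>p m. fst ((\<lambda>(\<sigma>', d') m. tick (min m d')) p m)) xs m
      = Min (insert m (snd ` set xs))" for xs :: "('b \<times> nat) list" and m
  proof (induction xs arbitrary: m)
    case (Cons p xs)
    have *: "Min (insert (min i m) A) = Min (insert i (insert m A))" if "finite A" for i m :: nat and A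
      using that by (cases "A = {}") (simp_all add: min.assoc)
    from Cons show ?case
      by (cases p) (simp add: * min.commute[of m] insert_commute[of m] del: Min_insert)
  qed simp
  have flt: "fst (filter_timed (\<lambda>(\<sigma>, d). subset_timed x \<sigma>) (fst (degrees_timed k0 S)))
      = map (\<lambda>\<sigma>. (\<sigma>, simplex_degree (set S) \<sigma>)) ?C"
    by (simp add: fst_degrees_timed[OF assms] filter_map o_def case_prod_unfold)
  show ?thesis
  proof (cases ?C)
    case Nil
    then have "{\<sigma> \<in> simplices (set S) (k0 + 1). x \<subseteq> \<sigma>} = {}"
      using set_C by (metis list.set(1))
    with Nil flt show ?thesis
      by (simp add: index_timed_def vertex_index_def)
  next
    case (Cons \<sigma> xs)
    then have "{\<sigma> \<in> simplices (set S) (k0 + 1). x \<subseteq> \<sigma>} = insert \<sigma> (set xs)"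
      using set_C by (metis list.set(2))
    with Cons flt show ?thesis
      by (simp add: index_timed_def vertex_index_def * image_image)
  qed
qed

lemma chain_space_vectorspace:
  "vectorspace class_ring (chain_space F S k)"
  unfolding chain_space_def vectorspace_def
  by (intro conjI class_field cring.func_space_is_module) (meson class_field domain_def field.axioms(1))

lemma carrier_chain_space: "carrier (chain_space F S k) = simplices S k \<rightarrow>\<^sub>E UNIV"
  unfolding chain_space_def by (simp add: ring.func_space_def[OF class_ring.ring_axioms])

lemma add_chain_space: "c \<oplus>\<^bsub>chain_space F S k\<^esub> d = (\<lambda>\<sigma>\<in>simplices S k. c \<sigma> + d \<sigma>)"
  unfolding chain_space_def by (simp add: ring.func_space_def[OF class_ring.ring_axioms])

lemma smult_chain_space: "a \<odot>\<^bsub>chain_space F S k\<^esub> c = (\<lambda>\<sigma>\<in>simplices S k. a * c \<sigma>)"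
  unfolding chain_space_def by (simp add: ring.func_space_def[OF class_ring.ring_axioms])

lemma zero_chain_space: "\<zero>\<^bsub>chain_space F S k\<^esub> = (\<lambda>\<sigma>\<in>simplices S k. 0)"
  unfolding chain_space_def by (simp add: ring.func_space_def[OF class_ring.ring_axioms])

lemma linear_boundary_map:
  "linear_map class_ring (chain_space (F :: 'f::field itself) S (k + 1)) (chain_space F S k) (boundary_map S k)"
proof -
  interpret V: vectorspace class_ring "chain_space F S (k + 1)"
    by (rule chain_space_vectorspace)
  interpret W: vectorspace class_ring "chain_space F S k"
    by (rule chain_space_vectorspace)
  have "boundary_map S k \<in> module_hom class_ring (chain_space F S (k + 1)) (chain_space F S k)"
    unfolding module_hom_def mem_Collect_eq
  proof (intro conjI allI impI)
    show "boundary_map S k \<in> carrier (chain_space F S (k + 1)) \<rightarrow> carrier (chain_space F S k)"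
      by (simp add: carrier_chain_space boundary_map_def)
    show "boundary_map S k (c \<oplus>\<^bsub>chain_space F S (k + 1)\<^esub> d)
        = boundary_map S k c \<oplus>\<^bsub>chain_space F S k\<^esub> boundary_map S k d" for c d
      unfolding add_chain_space boundary_map_def
      by (intro restrict_ext) (simp add: distrib_left sum.distrib)
    show "boundary_map S k (a \<odot>\<^bsub>chain_space F S (k + 1)\<^esub> c)
        = a \<odot>\<^bsub>chain_space F S k\<^esub> boundary_map S k c" for a c
      unfolding smult_chain_space boundary_map_def
      by (intro restrict_ext) (simp add: sum_distrib_left mult.left_commute)
  qed
  then show ?thesis
    by unfold_locales
qed

lemma incidence_remove:
  assumes "v \<in> \<tau>"
  shows "incidence (\<tau> - {v}) \<tau> = (- 1) ^ card {w \<in> \<tau>. w < v}"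
proof -
  have "{u. u \<in> \<tau> \<and> \<tau> - {v} = \<tau> - {u}} = {v}"
    using assms by auto
  then show ?thesis
    by (simp add: incidence_def)
qed

lemma incidence_eq_0:
  assumes "\<And>v. v \<in> \<tau> \<Longrightarrow> \<sigma> \<noteq> \<tau> - {v}"
  shows "incidence \<sigma> \<tau> = 0"
proof -
  have "{v. v \<in> \<tau> \<and> \<sigma> = \<tau> - {v}} = {}"
    using assms by auto
  then show ?thesis
    by (simp only: incidence_def sum.empty)
qed

lemma incidence_incidence:
  fixes S :: "'a::linorder set set"
  assumes S: "abstract_simplicial_complex S" and \<rho>: "\<rho> \<in> simplices S k" and \<tau>: "\<tau> \<in> simplices S (k + 2)"
  shows "(\<Sum>\<sigma>\<in>simplices S (k + 1). incidence \<rho> \<sigma> * incidence \<sigma> \<tau>) = (0 :: 'f::field)"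
proof (cases "\<rho> \<subseteq> \<tau>")
  case False
  then have "incidence \<rho> \<sigma> * incidence \<sigma> \<tau> = (0 :: 'f)" for \<sigma>
    by (metis Diff_subset incidence_eq_0 mult_eq_0_iff subset_trans)
  then show ?thesis by simp
next
  case True
  have fin: "finite \<tau>" "finite \<rho>"
    using S \<rho> \<tau> by (auto simp: abstract_simplicial_complex_def simplices_def)
  have "card (\<tau> - \<rho>) = 2"
    using \<rho> \<tau> fin True by (simp add: card_Diff_subset simplices_def)
  then obtain a b where ab: "\<tau> - \<rho> = {a, b}" "a < b"
    by (metis card_2_iff insert_commute linorder_less_linear)
  have \<tau>_eq: "\<tau> = insert a (insert b \<rho>)" and notin: "a \<notin> \<rho>" "b \<notin> \<rho>"
    using ab True by auto
  let ?A = "insert a \<rho>" and ?B = "insert b \<rho>"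
  have sub: "{?A, ?B} \<subseteq> simplices S (k + 1)"
  proof -
    have "X \<in> S" if "X \<subseteq> \<tau>" "X \<noteq> {}" for X
      using S \<tau> that unfolding abstract_simplicial_complex_def simplices_def by blast
    moreover have "?A \<subseteq> \<tau>" "?B \<subseteq> \<tau>"
      using \<tau>_eq by auto
    moreover have "card ?A = k + 2" "card ?B = k + 2"
      using \<rho> notin fin by (auto simp: simplices_def)
    ultimately show ?thesis
      by (simp add: simplices_def)
  qed
  have "incidence \<rho> \<sigma> * incidence \<sigma> \<tau> = (0 :: 'f)" if "\<sigma> \<notin> {?A, ?B}" for \<sigma>
  proof (rule ccontr)
    assume "\<not> ?thesis"
    then obtain u v where "u \<in> \<sigma>" "\<rho> = \<sigma> - {u}" "v \<in> \<tau>" "\<sigma> = \<tau> - {v}"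
      by (metis incidence_eq_0 mult_zero_left mult_zero_right)
    then have "\<sigma> = insert u \<rho>" "u \<in> \<tau> - \<rho>"
      by blast+
    then show False
      using that ab(1) by auto
  qed
  then have "(\<Sum>\<sigma>\<in>simplices S (k + 1). incidence \<rho> \<sigma> * incidence \<sigma> \<tau>)
      = (\<Sum>\<sigma>\<in>{?A, ?B}. incidence \<rho> \<sigma> * incidence \<sigma> \<tau> :: 'f)"
    using sub finite_simplices[OF S] by (intro sum.mono_neutral_right) blast+
  also have "\<dots> = incidence \<rho> ?A * incidence ?A \<tau> + incidence \<rho> ?B * incidence ?B \<tau>"
  proof -
    have "?A \<noteq> ?B"
      using notin ab(2) by (metis insert_iff order_less_irrefl)
    then show ?thesis by simp
  qed
  also have "incidence \<rho> ?A = ((- 1) ^ card {w \<in> \<rho>. w < a} :: 'f)"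
  proof -
    have "\<rho> = ?A - {a}" "{w \<in> ?A. w < a} = {w \<in> \<rho>. w < a}" using notin by auto
    then show ?thesis using incidence_remove[of a ?A] by simp
  qed
  also have "incidence \<rho> ?B = ((- 1) ^ card {w \<in> \<rho>. w < b} :: 'f)"
  proof -
    have "\<rho> = ?B - {b}" "{w \<in> ?B. w < b} = {w \<in> \<rho>. w < b}" using notin by auto
    then show ?thesis using incidence_remove[of b ?B] by simp
  qed
  also have "incidence ?A \<tau> = (- ((- 1) ^ card {w \<in> \<rho>. w < b}) :: 'f)"
  proof -
    have "?A = \<tau> - {b}" "{w \<in> \<tau>. w < b} = insert a {w \<in> \<rho>. w < b}"
      using notin ab \<tau>_eq by auto
    then show ?thesis using incidence_remove[of b \<tau>] notin fin \<tau>_eq by simp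
  qed
  also have "incidence ?B \<tau> = ((- 1) ^ card {w \<in> \<rho>. w < a} :: 'f)"
  proof -
    have "?B = \<tau> - {a}" "{w \<in> \<tau>. w < a} = {w \<in> \<rho>. w < a}"
      using notin ab \<tau>_eq by auto
    then show ?thesis using incidence_remove[of a \<tau>] \<tau>_eq by simp
  qed
  finally show ?thesis by simp
qed

lemma boundary_map_boundary_map:
  assumes "abstract_simplicial_complex S"
  shows "boundary_map S k (boundary_map S (k + 1) c) = (\<lambda>\<sigma>\<in>simplices S k. 0 :: 'f::field)"
proof -
  have "(\<Sum>\<sigma>\<in>simplices S (k + 1). incidence \<rho> \<sigma> * (\<Sum>\<tau>\<in>simplices S (k + 2). incidence \<sigma> \<tau> * c \<tau>)) = 0"
    if "\<rho> \<in> simplices S k" for \<rho>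
  proof -
    have "(\<Sum>\<sigma>\<in>simplices S (k + 1). incidence \<rho> \<sigma> * (\<Sum>\<tau>\<in>simplices S (k + 2). incidence \<sigma> \<tau> * c \<tau>))
      = (\<Sum>\<tau>\<in>simplices S (k + 2). (\<Sum>\<sigma>\<in>simplices S (k + 1). incidence \<rho> \<sigma> * incidence \<sigma> \<tau>) * c \<tau>)"
      unfolding sum_distrib_left sum_distrib_right by (subst sum.swap) (simp add: mult.assoc)
    also have "\<dots> = 0"
      by (rule sum.neutral) (use incidence_incidence[OF assms that] in auto)
    finally show ?thesis .
  qed
  then show ?thesis
    by (auto simp: boundary_map_def restrict_def fun_eq_iff)
qed

lemma boundary_space_subset:
  assumes "abstract_simplicial_complex S"
  shows "boundary_space F S k \<subseteq> cycle_space F S k"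
proof -
  have "boundary_map S k c \<in> carrier (chain_space F S k)" for c
    by (simp add: carrier_chain_space boundary_map_def)
  moreover have "case k of 0 \<Rightarrow> True | Suc j \<Rightarrow> boundary_map S j (boundary_map S k c) = \<zero>\<^bsub>chain_space F S j\<^esub>" for c
    using boundary_map_boundary_map[OF assms, of _ c]
    by (auto simp: zero_chain_space split: nat.splits)
  ultimately show ?thesis
    by (auto simp: boundary_space_def cycle_space_def)
qed

lemma quotient_space_linear_map:
  assumes V: "vectorspace K V" and B: "submodule K B V"
  shows "vectorspace K (quotient_space V B)"
    and "linear_map K V (quotient_space V B) (\<lambda>x. B +>\<^bsub>V\<^esub> x)"
    and "(\<lambda>x. B +>\<^bsub>V\<^esub> x) ` carrier V = carrier (quotient_space V B)"
    and "{x \<in> carrier V. B +>\<^bsub>V\<^esub> x = \<zero>\<^bsub>quotient_space V B\<^esub>} = B"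
proof -
  interpret V: vectorspace K V by fact
  interpret B: submodule K B V by fact
  have ab: "abelian_group V"
    using V by (simp add: vectorspace_def module_def)
  have neg: "\<ominus>\<^bsub>V\<^esub> x \<in> B" if "x \<in> B" for x
  proof -
    have "\<ominus>\<^bsub>K\<^esub> \<one>\<^bsub>K\<^esub> \<in> carrier K" "x \<in> carrier V"
      using that B.subset by auto
    then show ?thesis
      using that V.module.smult_minus_1[of x] B.smult_closed[of "\<ominus>\<^bsub>K\<^esub> \<one>\<^bsub>K\<^esub>" x] by metis
  qed
  have sub: "subgroup B (add_monoid V)"
    by (rule group.subgroupI[OF ab[THEN abelian_group.a_group]])
       (use B.subset B.zero_closed neg in \<open>auto simp flip: a_inv_def simp del: B.zero_closed\<close>)
  then interpret B: abelian_subgroup B V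
    by (intro abelian_subgroupI3 additive_subgroup.intro ab)
  let ?Q = "quotient_space V B" and ?p = "\<lambda>x. B +>\<^bsub>V\<^esub> x"
  have carrier: "carrier ?Q = ?p ` carrier V"
    by (auto simp: quotient_space_def A_RCOSETS_def')
  have zero: "\<zero>\<^bsub>?Q\<^esub> = ?p \<zero>\<^bsub>V\<^esub>"
    by (simp add: quotient_space_def V.module.M.a_coset_add_zero B.subset)
  have add: "?p x \<oplus>\<^bsub>?Q\<^esub> ?p y = ?p (x \<oplus>\<^bsub>V\<^esub> y)" if "x \<in> carrier V" "y \<in> carrier V" for x y
    using that by (simp add: quotient_space_def B.a_rcos_sum)
  have smult: "a \<odot>\<^bsub>?Q\<^esub> ?p x = ?p (a \<odot>\<^bsub>V\<^esub> x)" if "a \<in> carrier K" "x \<in> carrier V" for a x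
  proof -
    have eq: "?p (a \<odot>\<^bsub>V\<^esub> y) = ?p (a \<odot>\<^bsub>V\<^esub> x)" if y: "y \<in> ?p x" for y
    proof -
      obtain b where b: "b \<in> B" "y = b \<oplus>\<^bsub>V\<^esub> x"
        using y by (auto simp: a_r_coset_def')
      then have "a \<odot>\<^bsub>V\<^esub> y = (a \<odot>\<^bsub>V\<^esub> b) \<oplus>\<^bsub>V\<^esub> (a \<odot>\<^bsub>V\<^esub> x)"
        using that \<open>a \<in> carrier K\<close> \<open>x \<in> carrier V\<close> B.subset by (simp add: V.module.smult_r_distr subset_iff)
      then have "a \<odot>\<^bsub>V\<^esub> y \<in> ?p (a \<odot>\<^bsub>V\<^esub> x)"
        using b \<open>a \<in> carrier K\<close> by (auto simp: a_r_coset_def')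
      then show ?thesis
        using \<open>a \<in> carrier K\<close> \<open>x \<in> carrier V\<close> V.module.M.a_repr_independence[OF _ _ sub, of "a \<odot>\<^bsub>V\<^esub> y" "a \<odot>\<^bsub>V\<^esub> x"]
        by auto
    qed
    have "x \<in> ?p x"
      using that by (simp add: B.a_rcos_self)
    then have "?p x \<noteq> {}"
      by blast
    from SUP_eq_const[OF this eq] have "(\<Union>y\<in>?p x. ?p (a \<odot>\<^bsub>V\<^esub> y)) = ?p (a \<odot>\<^bsub>V\<^esub> x)"
      by simp
    then show ?thesis
      by (simp add: quotient_space_def)
  qed
  have neg': "?p x \<oplus>\<^bsub>?Q\<^esub> ?p (\<ominus>\<^bsub>V\<^esub> x) = \<zero>\<^bsub>?Q\<^esub>" if "x \<in> carrier V" for x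
    using that by (simp add: add zero V.module.M.r_neg)
  show vs: "vectorspace K ?Q"
  proof (rule vs_criteria)
    show "\<forall>v\<in>carrier ?Q. \<exists>w\<in>carrier ?Q. v \<oplus>\<^bsub>?Q\<^esub> w = \<zero>\<^bsub>?Q\<^esub>"
      unfolding carrier using neg' by (blast intro: V.module.M.a_inv_closed)
    show "\<forall>v w x. v \<in> carrier ?Q \<and> w \<in> carrier ?Q \<and> x \<in> carrier ?Q \<longrightarrow>
        v \<oplus>\<^bsub>?Q\<^esub> w \<oplus>\<^bsub>?Q\<^esub> x = v \<oplus>\<^bsub>?Q\<^esub> (w \<oplus>\<^bsub>?Q\<^esub> x)"
      by (auto simp: carrier add V.module.M.a_assoc)
    show "\<forall>v w. v \<in> carrier ?Q \<and> w \<in> carrier ?Q \<longrightarrow> v \<oplus>\<^bsub>?Q\<^esub> w = w \<oplus>\<^bsub>?Q\<^esub> v"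
      by (auto simp: carrier add V.module.M.a_comm)
    show "field K"
      using V by (simp add: vectorspace_def)
  qed (auto simp: carrier zero add smult V.module.smult_l_distr V.module.smult_r_distr
        V.module.smult_assoc1)
  show "?p ` carrier V = carrier ?Q"
    by (simp add: carrier)
  show "{x \<in> carrier V. ?p x = \<zero>\<^bsub>?Q\<^esub>} = B"
    using B.subset B.a_rcos_const B.a_rcos_self by (auto simp: quotient_space_def)
  interpret Q: vectorspace K ?Q by (rule vs)
  show "linear_map K V ?Q ?p"
    by unfold_locales (auto simp: module_hom_def carrier add smult)
qed

lemma dim_quotient_space:
  assumes V: "vectorspace K V" and fin: "vectorspace.fin_dim K V" and B: "submodule K B V"
  shows "vectorspace.dim K (quotient_space V B) + vectorspace.dim K (V\<lparr>carrier := B\<rparr>) = vectorspace.dim K V"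
proof -
  let ?Q = "quotient_space V B" and ?p = "\<lambda>x. B +>\<^bsub>V\<^esub> x"
  note q = quotient_space_linear_map[OF V B]
  interpret p: linear_map K V ?Q ?p
    by (rule q(2))
  have "p.mod_hom.im = carrier ?Q" "p.mod_hom.ker = B"
    using q(3,4) by (auto simp: p.mod_hom.im_def p.mod_hom.ker_def)
  then show ?thesis
    using p.rank_nullity[OF fin] by simp
qed

lemma subspace_fin_dim:
  assumes V: "vectorspace K V" and fd: "vectorspace.fin_dim K V" and N: "submodule K N V"
  shows "vectorspace.fin_dim K (V\<lparr>carrier := N\<rparr>)"
proof -
  interpret V: vectorspace K V by fact
  interpret N: vectorspace K "V\<lparr>carrier := N\<rparr>"
    using V N by (intro V.subspace_is_vs) (simp add: subspace_def)
  have NC: "N \<subseteq> carrier V"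
    using N by (rule submodule.subset)
  have small: "finite A \<and> card A \<le> V.dim" if "A \<subseteq> N" "N.lin_indpt A" for A
    using that V.span_li_not_depend(2)[OF _ N, of A] fd NC by (auto intro!: V.li_le_dim)
  have "\<exists>A. finite A \<and> maximal A (\<lambda>S. S \<subseteq> carrier (V\<lparr>carrier := N\<rparr>) \<and> N.lin_indpt S)"
    by (intro maximal_exists[where N = "V.dim" and B = "{}"])
       (use small in \<open>auto simp: N.lin_dep_def\<close>)
  then obtain A where A: "finite A" "maximal A (\<lambda>S. S \<subseteq> carrier (V\<lparr>carrier := N\<rparr>) \<and> N.lin_indpt S)"
    by blast
  then have "N.basis A"
    by (intro N.max_li_is_basis) (auto simp: maximal_def)
  then show ?thesis
    unfolding N.fin_dim_def N.basis_def using A(1) by blast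
qed

definition chain_of_vec :: "'a set list \<Rightarrow> 'f::field vec \<Rightarrow> ('a set \<Rightarrow> 'f)" where
  "chain_of_vec xs v = (\<lambda>\<sigma>\<in>set xs. \<Sum>i<length xs. if xs ! i = \<sigma> then v $ i else 0)"

lemma chain_of_vec_nth:
  assumes "distinct xs" "i < length xs"
  shows "chain_of_vec xs v (xs ! i) = v $ i"
proof -
  have "(\<Sum>j<length xs. if xs ! j = xs ! i then v $ j else 0) = (\<Sum>j<length xs. if j = i then v $ j else 0)"
    using assms by (intro sum.cong) (auto simp: nth_eq_iff_index_eq)
  then show ?thesis
    using assms(2) by (simp add: chain_of_vec_def)
qed

lemma chain_of_vec_eqI:
  assumes "distinct xs" "c \<in> extensional (set xs)" "\<And>i. i < length xs \<Longrightarrow> c (xs ! i) = v $ i"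
  shows "c = chain_of_vec xs v"
proof
  fix \<sigma>
  show "c \<sigma> = chain_of_vec xs v \<sigma>"
  proof (cases "\<sigma> \<in> set xs")
    case True
    then show ?thesis
      using assms chain_of_vec_nth[OF assms(1)] by (metis in_set_conv_nth)
  next
    case False
    then show ?thesis
      using assms(2) by (simp add: extensional_def chain_of_vec_def)
  qed
qed

context
  fixes S :: "'a::linorder set set" and k :: nat and xs :: "'a set list"
  assumes xs: "distinct xs" "set xs = simplices S k"
begin

lemma chain_of_vec_linear:
  "linear_map class_ring (module_vec TYPE('f::field) (length xs)) (chain_space TYPE('f) S k)
     (chain_of_vec xs)"
proof -
  let ?n = "length xs"
  interpret V: vectorspace class_ring "module_vec TYPE('f) ?n"
    by (rule vec_vs)
  interpret W: vectorspace class_ring "chain_space TYPE('f) S k"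
    by (rule chain_space_vectorspace)
  have "chain_of_vec xs \<in> module_hom class_ring (module_vec TYPE('f) ?n) (chain_space TYPE('f) S k)"
    unfolding module_hom_def mem_Collect_eq
  proof (intro conjI allI impI)
    show "chain_of_vec xs \<in> carrier (module_vec TYPE('f) ?n) \<rightarrow> carrier (chain_space TYPE('f) S k)"
      by (simp add: carrier_chain_space chain_of_vec_def xs(2))
    fix u v assume "u \<in> carrier (module_vec TYPE('f) ?n) \<and> v \<in> carrier (module_vec TYPE('f) ?n)"
    then show "chain_of_vec xs (u \<oplus>\<^bsub>module_vec TYPE('f) ?n\<^esub> v)
        = chain_of_vec xs u \<oplus>\<^bsub>chain_space TYPE('f) S k\<^esub> chain_of_vec xs v"
      by (intro chain_of_vec_eqI[symmetric] xs(1))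
         (auto simp: add_chain_space xs(2)[symmetric] chain_of_vec_nth xs(1) module_vec_simps)
  next
    fix a v assume "a \<in> carrier (class_ring :: 'f ring) \<and> v \<in> carrier (module_vec TYPE('f) ?n)"
    then show "chain_of_vec xs (a \<odot>\<^bsub>module_vec TYPE('f) ?n\<^esub> v)
        = a \<odot>\<^bsub>chain_space TYPE('f) S k\<^esub> chain_of_vec xs v"
      by (intro chain_of_vec_eqI[symmetric] xs(1))
         (auto simp: smult_chain_space xs(2)[symmetric] chain_of_vec_nth xs(1) module_vec_simps)
  qed
  then show ?thesis
    by unfold_locales
qed

lemma chain_of_vec_inj: "inj_on (chain_of_vec xs) (carrier_vec (length xs) :: 'f::field vec set)"
  by (intro inj_onI eq_vecI) (auto, metis chain_of_vec_nth xs(1))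

lemma chain_of_vec_surj:
  "chain_of_vec xs ` carrier_vec (length xs) = carrier (chain_space TYPE('f::field) S k)"
proof
  show "chain_of_vec xs ` carrier_vec (length xs) \<subseteq> carrier (chain_space TYPE('f) S k)"
    by (auto simp: carrier_chain_space chain_of_vec_def xs(2))
  show "carrier (chain_space TYPE('f) S k) \<subseteq> chain_of_vec xs ` carrier_vec (length xs)"
  proof
    fix c assume "c \<in> carrier (chain_space TYPE('f) S k)"
    then have "c = chain_of_vec xs (vec (length xs) (\<lambda>i. c (xs ! i)))"
      by (intro chain_of_vec_eqI xs(1)) (auto simp: carrier_chain_space xs(2) PiE_def)
    then show "c \<in> chain_of_vec xs ` carrier_vec (length xs)"
      by (metis image_eqI vec_carrier)
  qed
qed

lemma dim_chain_space:
  "vectorspace.fin_dim class_ring (chain_space TYPE('f::field) S k)"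
  "vectorspace.dim class_ring (chain_space TYPE('f) S k) = length xs"
proof -
  interpret v: vec_space "TYPE('f)" "length xs" .
  interpret T: linear_map class_ring "module_vec TYPE('f) (length xs)" "chain_space TYPE('f) S k"
    "chain_of_vec xs"
    by (rule chain_of_vec_linear)
  show "vectorspace.fin_dim class_ring (chain_space TYPE('f) S k)"
    by (rule T.surj_fin_dim) (use v.fin_dim chain_of_vec_surj in \<open>auto simp: module_vec_simps\<close>)
  show "vectorspace.dim class_ring (chain_space TYPE('f) S k) = length xs"
    using T.dim_eq[OF v.fin_dim] chain_of_vec_inj[where 'f = 'f] chain_of_vec_surj[where 'f = 'f] v.dim_is_n
    by (auto simp: module_vec_simps)
qed

end

lemma boundary_map_chain_of_vec:
  fixes v :: "'f::field vec"
  assumes R: "distinct R" "set R = simplices S k" and C: "distinct C" "set C = simplices S (k + 1)"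
  assumes A: "A = mat (length R) (length C) (\<lambda>(i, j). incidence (R ! i) (C ! j))"
    and v: "v \<in> carrier_vec (length C)"
  shows "boundary_map S k (chain_of_vec C v) = chain_of_vec R (A *\<^sub>v v)"
proof (rule chain_of_vec_eqI[OF R(1)])
  show "boundary_map S k (chain_of_vec C v) \<in> extensional (set R)"
    by (simp add: boundary_map_def R(2))
  fix i assume i: "i < length R"
  then have "R ! i \<in> simplices S k"
    using R(2) by (metis nth_mem)
  then have "boundary_map S k (chain_of_vec C v) (R ! i)
      = (\<Sum>\<tau>\<in>set C. incidence (R ! i) \<tau> * chain_of_vec C v \<tau>)"
    by (simp add: boundary_map_def C(2))
  also have "\<dots> = (\<Sum>j<length C. incidence (R ! i) (C ! j) * chain_of_vec C v (C ! j))"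
    by (rule sum.reindex_bij_betw[symmetric, OF bij_betw_nth[OF C(1) refl refl]])
  also have "\<dots> = (A *\<^sub>v v) $ i"
    using i v C(1) by (auto simp: A scalar_prod_def chain_of_vec_nth atLeast0LessThan intro!: sum.cong)
  finally show "boundary_map S k (chain_of_vec C v) (R ! i) = (A *\<^sub>v v) $ i" .
qed

lemma dim_boundary_space:
  assumes R: "distinct R" "set R = simplices S k" and C: "distinct C" "set C = simplices S (k + 1)"
  assumes A: "A = mat (length R) (length C) (\<lambda>(i, j). incidence (R ! i) (C ! j) :: 'f::field)"
  shows "vectorspace.dim class_ring ((chain_space TYPE('f::field) S k)\<lparr>carrier := boundary_space TYPE('f::field) S k\<rparr>)
    = vec_space.rank (length R) A"
proof -
  let ?V = "module_vec TYPE('f) (length R)" and ?W = "chain_space TYPE('f) S k"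
  interpret v: vec_space "TYPE('f)" "length R" .
  have A': "A \<in> carrier_mat (length R) (length C)"
    by (simp add: A)
  interpret T: linear_map class_ring ?V ?W "chain_of_vec R"
    by (rule chain_of_vec_linear[OF R])
  interpret D: linear_map class_ring "chain_space TYPE('f) S (k + 1)" ?W "boundary_map S k"
    by (rule linear_boundary_map)
  have sub: "set (cols A) \<subseteq> carrier ?V"
    using cols_dim[of A] A' by (simp add: module_vec_simps)
  let ?X = "v.span (set (cols A))" and ?Y = "boundary_space TYPE('f) S k"
  have X: "?X = {A *\<^sub>v u | u. u \<in> carrier_vec (length C)}"
    using v.col_space_eq[OF A'] A' by (auto simp: v.col_space_def)
  have "?Y = boundary_map S k ` chain_of_vec C ` carrier_vec (length C)"
    by (simp add: boundary_space_def chain_of_vec_surj[OF C])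
  also have "\<dots> = chain_of_vec R ` ?X"
    using boundary_map_chain_of_vec[OF R C A] by (auto simp: X image_iff)
  finally have Y: "chain_of_vec R ` ?X = ?Y" by simp
  have X_sub: "subspace class_ring ?X ?V"
    using sub by (intro v.span_is_subspace) (simp add: module_vec_simps)
  have Y_sub: "subspace class_ring ?Y ?W"
    using D.imT_is_subspace unfolding D.im_def boundary_space_def .
  have X_vs: "vectorspace class_ring (?V\<lparr>carrier := ?X\<rparr>)"
    by (rule vectorspace.subspace_is_vs[OF vec_vs X_sub])
  have Y_vs: "vectorspace class_ring (?W\<lparr>carrier := ?Y\<rparr>)"
    by (rule vectorspace.subspace_is_vs[OF chain_space_vectorspace Y_sub])
  have X_le: "?X \<subseteq> carrier ?V"
    using A' by (auto simp: X module_vec_simps)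
  interpret X: vectorspace class_ring "?V\<lparr>carrier := ?X\<rparr>" by (rule X_vs)
  interpret Y: vectorspace class_ring "?W\<lparr>carrier := ?Y\<rparr>" by (rule Y_vs)
  have "chain_of_vec R \<in> module_hom class_ring (?V\<lparr>carrier := ?X\<rparr>) (?W\<lparr>carrier := ?Y\<rparr>)"
  proof -
    have "chain_of_vec R (u \<oplus>\<^bsub>?V\<^esub> w) = chain_of_vec R u \<oplus>\<^bsub>?W\<^esub> chain_of_vec R w"
      if "u \<in> ?X" "w \<in> ?X" for u w
      by (rule module_hom_add[OF T.f_hom]) (use that X_le in blast)+
    moreover have "chain_of_vec R (a \<odot>\<^bsub>?V\<^esub> u) = a \<odot>\<^bsub>?W\<^esub> chain_of_vec R u"
      if "u \<in> ?X" for a u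
      by (rule module_hom_smult[OF T.f_hom]) (use that X_le in auto)
    moreover have "chain_of_vec R \<in> ?X \<rightarrow> ?Y"
      using Y by blast
    ultimately show ?thesis
      unfolding module_hom_def by simp
  qed
  then interpret U: linear_map class_ring "?V\<lparr>carrier := ?X\<rparr>" "?W\<lparr>carrier := ?Y\<rparr>" "chain_of_vec R"
    by unfold_locales
  have "X.dim = Y.dim"
    using X_le Y inj_on_subset[OF chain_of_vec_inj[OF R, where 'f = 'f], of ?X] v.fin_dim_span_cols[OF A']
    by (intro U.dim_eq) (auto simp: module_vec_simps)
  then show ?thesis
    by (simp add: v.rank_def)
qed

lemma betti_eq_rank:
  assumes S: "abstract_simplicial_complex S" and C: "distinct C" "set C = simplices S k"
  assumes r: "r = (case k of 0 \<Rightarrow> 0 | Suc j \<Rightarrow>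
      vectorspace.dim class_ring ((chain_space TYPE('f::field) S j)\<lparr>carrier := boundary_space TYPE('f::field) S j\<rparr>))"
    and r': "r' = vectorspace.dim class_ring ((chain_space TYPE('f::field) S k)\<lparr>carrier := boundary_space TYPE('f::field) S k\<rparr>)"
  shows "betti TYPE('f::field) S k = length C - r - r'"
proof -
  let ?V = "chain_space TYPE('f) S k" and ?Z = "cycle_space TYPE('f) S k"
    and ?B = "boundary_space TYPE('f) S k"
  interpret V: vectorspace class_ring ?V
    by (rule chain_space_vectorspace)
  interpret D: linear_map class_ring "chain_space TYPE('f) S (k + 1)" ?V "boundary_map S k"
    by (rule linear_boundary_map)
  note fin = dim_chain_space(1)[OF C, where 'f = 'f] and dim = dim_chain_space(2)[OF C, where 'f = 'f]
  have B: "submodule class_ring ?B ?V"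
    using D.im_is_submodule unfolding D.im_def boundary_space_def .
  have Z: "submodule class_ring ?Z ?V \<and> V.dim = r + vectorspace.dim class_ring (?V\<lparr>carrier := ?Z\<rparr>)"
  proof (cases k)
    case 0
    then have "?Z = carrier ?V"
      by (simp add: cycle_space_def)
    moreover have "submodule class_ring (carrier ?V) ?V"
      by unfold_locales auto
    ultimately show ?thesis
      using 0 r by simp
  next
    case (Suc j)
    interpret E: linear_map class_ring "chain_space TYPE('f) S (j + 1)" "chain_space TYPE('f) S j"
      "boundary_map S j"
      by (rule linear_boundary_map)
    have "?Z = E.ker" "boundary_space TYPE('f) S j = E.im"
      unfolding E.ker_def E.im_def by (simp_all add: Suc cycle_space_def boundary_space_def)
    then show ?thesis
      using E.ker_is_submodule E.rank_nullity fin r Suc by simp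
  qed
  have BZ: "?B \<subseteq> ?Z"
    by (rule boundary_space_subset[OF S])
  interpret Z: vectorspace class_ring "?V\<lparr>carrier := ?Z\<rparr>"
    using Z by (intro V.subspace_is_vs) (simp add: subspace_def V.vectorspace_axioms)
  have "submodule class_ring ?B (?V\<lparr>carrier := ?Z\<rparr>)"
    using B BZ Z.module_axioms by (auto simp: submodule_def)
  from dim_quotient_space[OF Z.vectorspace_axioms subspace_fin_dim[OF V.vectorspace_axioms fin] this] Z
  show ?thesis
    using r' dim by (simp add: betti_def homology_def)
qed

lemma fst_sign_timed:
  assumes "set us \<subseteq> \<sigma>" "v \<notin> \<sigma>"
  shows "fst (sign_timed \<sigma> (us @ v # vs) s) = s * (- 1) ^ length us"
  using assms by (induction us arbitrary: s) auto

lemma fst_incidence_timed: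
  fixes \<sigma> \<tau> :: "'a::linorder set"
  assumes "finite \<tau>" "card \<tau> = card \<sigma> + 1"
  shows "fst (incidence_timed \<sigma> \<tau>) = (incidence \<sigma> \<tau> :: 'f::field)"
proof (cases "\<sigma> \<subseteq> \<tau>")
  case False
  then have "\<sigma> \<noteq> \<tau> - {v}" for v
    by blast
  with False show ?thesis
    by (simp add: incidence_timed_def incidence_eq_0)
next
  case True
  then have "card (\<tau> - \<sigma>) = 1"
    using assms by (simp add: card_Diff_subset finite_subset)
  then obtain v where v: "\<tau> - \<sigma> = {v}"
    by (metis card_1_singletonE)
  have \<sigma>: "\<sigma> = \<tau> - {v}" and "v \<in> \<tau>" "v \<notin> \<sigma>"
    using v True by auto
  then obtain us vs where l: "sorted_list_of_set \<tau> = us @ v # vs"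
    using split_list[of v "sorted_list_of_set \<tau>"] assms(1) by auto
  have sorted: "sorted (us @ v # vs)" "distinct (us @ v # vs)" "set (us @ v # vs) = \<tau>"
    unfolding l[symmetric] using assms(1) by simp_all
  have us: "set us = {w \<in> \<tau>. w < v}"
    using sorted by (fastforce simp: sorted_append)
  then have "length us = card {w \<in> \<tau>. w < v}"
    using sorted(2) distinct_card[of us] by simp
  moreover have "set us \<subseteq> \<sigma>"
    using us \<sigma> by auto
  moreover have "(incidence \<sigma> \<tau> :: 'f) = (- 1) ^ card {w \<in> \<tau>. w < v}"
    using incidence_remove[OF \<open>v \<in> \<tau>\<close>] unfolding \<sigma>[symmetric] .
  ultimately have "fst (sign_timed \<sigma> (sorted_list_of_set \<tau>) 1) = (incidence \<sigma> \<tau> :: 'f)"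
    using fst_sign_timed[of us \<sigma> v vs "1 :: 'f"] \<open>v \<notin> \<sigma>\<close>
    by (simp add: l)
  with True show ?thesis
    by (simp add: incidence_timed_def)
qed

lemma fst_boundary_matrix_timed:
  fixes S :: "'a::linorder set list"
  defines "X \<equiv> \<lambda>k. filter (\<lambda>\<sigma>. card \<sigma> = k + 1) S"
  assumes "abstract_simplicial_complex (set S)"
  shows "fst (boundary_matrix_timed S k)
    = mat (length (X k)) (length (X (k + 1))) (\<lambda>(i, j). incidence (X k ! i) (X (k + 1) ! j) :: 'f::field)"
proof -
  have "fst (incidence_timed \<sigma> \<tau>) = (incidence \<sigma> \<tau> :: 'f)" if "\<sigma> \<in> set (X k)" "\<tau> \<in> set (X (k + 1))" for \<sigma> \<tau>
    using that assms by (intro fst_incidence_timed) (auto simp: abstract_simplicial_complex_def)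
  then have "map (\<lambda>\<tau>. map (\<lambda>\<sigma>. fst (incidence_timed \<sigma> \<tau>)) (X k)) (X (k + 1))
      = map (\<lambda>\<tau>. map (\<lambda>\<sigma>. incidence \<sigma> \<tau> :: 'f) (X k)) (X (k + 1))"
    by (intro map_cong refl) auto
  moreover have "fst (boundary_matrix_timed S k) = mat_of_cols_list (length (X k))
      (map (\<lambda>\<tau>. map (\<lambda>\<sigma>. fst (incidence_timed \<sigma> \<tau> :: 'f timed)) (X k)) (X (k + 1)))"
    by (simp add: boundary_matrix_timed_def X_def)
  ultimately have "fst (boundary_matrix_timed S k)
      = mat_of_cols_list (length (X k)) (map (\<lambda>\<tau>. map (\<lambda>\<sigma>. incidence \<sigma> \<tau> :: 'f) (X k)) (X (k + 1)))"
    by (simp only:)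
  then show ?thesis
    by (auto simp: mat_of_cols_list_def intro!: eq_matI)
qed

lemma fst_boundary_rank_timed:
  fixes rc :: "'f::field mat \<Rightarrow> nat"
  assumes S: "abstract_simplicial_complex (set S)" "distinct S"
  shows "fst (boundary_rank_timed rc S k) = vectorspace.dim class_ring
    ((chain_space TYPE('f) (set S) k)\<lparr>carrier := boundary_space TYPE('f) (set S) k\<rparr>)"
proof -
  let ?X = "\<lambda>k. filter (\<lambda>\<sigma>. card \<sigma> = k + 1) S"
  have "distinct (?X k)" "distinct (?X (k + 1))"
    using S(2) by simp_all
  from dim_boundary_space[OF this(1) simplices_filter this(2) simplices_filter refl, where 'f = 'f]
  show ?thesis
    by (simp add: boundary_rank_timed_def rank_timed_def fst_boundary_matrix_timed[OF S(1)])
qed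

lemma fst_betti_timed:
  fixes rc :: "'f::field mat \<Rightarrow> nat"
  assumes S: "abstract_simplicial_complex (set S)" "distinct S"
  shows "fst (betti_timed rc S k) = betti TYPE('f) (set S) k"
proof -
  let ?C = "filter (\<lambda>\<sigma>. card \<sigma> = k + 1) S"
  have "distinct ?C"
    using S(2) by simp
  from betti_eq_rank[OF S(1) this simplices_filter refl refl, where 'f = 'f]
  show ?thesis
    by (simp add: betti_timed_def fst_boundary_rank_timed[OF S] split: nat.split)
qed

lemma fst_betti_list_timed:
  fixes rc :: "'f::field mat \<Rightarrow> nat"
  assumes S: "abstract_simplicial_complex (set S)" "distinct S"
  shows "fst (betti_list_timed rc k0 S) = map (betti TYPE('f) (set S)) [0..<k0 + 1]"
  by (simp add: betti_list_timed_def fst_betti_timed[OF S])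

lemma fst_init_timed:
  fixes rc :: "'f::field mat \<Rightarrow> nat"
  assumes S: "abstract_simplicial_complex (set S)" "distinct S"
  shows "fst (init_timed rc k0 S L) =
    (map (betti TYPE('f) (set S)) [0..<k0 + 1],
     map (\<lambda>x. (x, if x \<in> set L then - 1 else int (vertex_index (set S) k0 x)))
       (filter (\<lambda>\<sigma>. card \<sigma> = 1) S))"
proof -
  have "fold (\<lambda>x I. fst (flag_timed x I)) L I
      = map (\<lambda>(y, i). (y, if y \<in> set L then - 1 else i)) I" for I :: "('a set \<times> int) list"
    by (induction L arbitrary: I) (auto simp: fst_flag_timed)
  then show ?thesis
    by (simp add: init_timed_def fst_betti_list_timed[OF S] fst_index_timed[OF S(1)])
qed

lemma simplicial_complex_remove:
  assumes "abstract_simplicial_complex (set S)"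
  shows "abstract_simplicial_complex (set (filter (\<lambda>\<sigma>. \<not> x \<subseteq> \<sigma>) S))"
  using assms unfolding abstract_simplicial_complex_def by (auto dest: subset_trans)

lemma fst_step_timed:
  fixes rc :: "'f::field mat \<Rightarrow> nat"
  assumes S: "abstract_simplicial_complex (set S)" "distinct S"
    and b: "b = map (betti TYPE('f) (set S)) [0..<k0 + 1]"
    and S': "S' = filter (\<lambda>\<sigma>. \<not> x \<subseteq> \<sigma>) S"
  shows "fst (step_timed rc k0 b S I x) =
    (if \<exists>k\<le>k0. betti TYPE('f) (set S') k \<noteq> betti TYPE('f) (set S) k
     then (S, map (\<lambda>(y, i). (y, if y = x then - 1 else i)) I)
     else (S', map (\<lambda>(y, i). (y, if i = - 1 then - 1 else int (vertex_index (set S') k0 y)))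
                 (filter (\<lambda>(y, i). y \<noteq> x) I)))"
proof -
  let ?b' = "map (betti TYPE('f) (set S')) [0..<k0 + 1]"
  have "abstract_simplicial_complex (set S')" "distinct S'"
    using simplicial_complex_remove[OF S(1)] S(2) by (simp_all add: S')
  note betti = fst_betti_list_timed[OF this] and index = fst_index_timed[OF this(1)]
  have *: "fold (\<lambda>p e. fst ((\<lambda>(u, v) e. tick (e \<or> u \<noteq> v)) p e)) ps e
      \<longleftrightarrow> e \<or> (\<exists>(u, v)\<in>set ps. u \<noteq> v)" for ps :: "(nat \<times> nat) list" and e
    by (induction ps arbitrary: e) auto
  have "set (zip b ?b') = (\<lambda>k. (betti TYPE('f) (set S) k, betti TYPE('f) (set S') k)) ` {0..<k0 + 1}"
    unfolding b by (simp add: zip_map_map zip_same_conv_map del: upt_Suc)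
  then have changed: "fst (fold_timed (\<lambda>(u, v) e. tick (e \<or> u \<noteq> v)) (zip b ?b') False)
      \<longleftrightarrow> (\<exists>k\<le>k0. betti TYPE('f) (set S') k \<noteq> betti TYPE('f) (set S) k)"
    unfolding fst_fold_timed * by (auto simp: Bex_def less_Suc_eq_le)
  have filt: "fst (filter_timed (\<lambda>\<sigma>. do { c \<leftarrow> subset_timed x \<sigma>; tick (\<not> c) }) S) = S'"
    by (simp add: S')
  have m: "fst (case p of (y, i) \<Rightarrow> do {
              f \<leftarrow> tick (i = - 1);
              if f then tick (y, i)
              else do { j \<leftarrow> index_timed (fst (degrees_timed k0 S')) y; tick (y, int j) } })
     = (case p of (y, i) \<Rightarrow> (y, if i = - 1 then - 1 else int (vertex_index (set S') k0 y)))"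
    for p :: "'a set \<times> int"
    by (cases p) (simp add: index)
  have f: "fst (case p of (y, i) \<Rightarrow> tick (y \<noteq> x)) = (case p of (y, i) \<Rightarrow> y \<noteq> x)"
    for p :: "'a set \<times> int"
    by (cases p) simp
  show ?thesis
    unfolding step_timed_def fst_bind_timed filt betti changed if_distrib[of fst] fst_tick
      fst_flag_timed
    unfolding fst_map_timed fst_filter_timed m f ..
qed

end

theory Submission
  imports Defs
begin

text \<open>Let \<open>p = s0 ^ (k0 + 2)\<close>, which bounds the number of \<open>k\<close>-simplices for every \<open>k \<le> k0 + 1\<close>, and
  let \<open>N\<close> be the number of all simplices. The ranks needed for the Betti numbers cost \<open>O(p ^ 3)\<close>
  and the degrees of the \<open>(k0 + 1)\<close>-simplices cost \<open>O(p * N)\<close>; every other operation of one passage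
  through the loop is dominated by these two. Each passage either deletes or flags a \<open>0\<close>-simplex
  whose index was not \<open>- 1\<close>, so there are at most \<open>s0\<close> passages. Since \<open>N\<close> is at most
  \<open>(k0 + 2) * p\<close> plus the number of simplices of dimension at least \<open>k0 + 2\<close>, the total
  \<open>O(s0 * (p ^ 3 + p * N))\<close> is the claimed bound.\<close>

section \<open>Running times of the list traversals and of the elementary routines\<close>

lemma snd_tick [simp]: "snd (tick x) = 1"
  by (simp add: tick_def)

lemma snd_ret [simp]: "snd (ret x) = 0"
  by (simp add: ret_def)

lemma snd_bind_timed [simp]: "snd (bind_timed m f) = snd m + snd (f (fst m))"
  by (simp add: bind_timed_def split: prod.splits)

lemma snd_subset_timed [simp]: "snd (subset_timed \<sigma> \<tau>) = 1"
  by (simp add: subset_timed_def)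

lemma snd_has_dim_timed [simp]: "snd (has_dim_timed k \<sigma>) = 1"
  by (simp add: has_dim_timed_def)

lemma snd_map_timed_le:
  assumes "\<And>x. x \<in> set xs \<Longrightarrow> snd (f x) \<le> B"
  shows "snd (map_timed f xs) \<le> length xs * (B + 1) + 1"
  using assms by (induction xs) (simp_all, fastforce)

lemma snd_filter_timed_le:
  assumes "\<And>x. x \<in> set xs \<Longrightarrow> snd (p x) \<le> B"
  shows "snd (filter_timed p xs) \<le> length xs * (B + 1) + 1"
  using assms by (induction xs) (simp_all, fastforce)

text \<open>The accumulators met along the fold are not tracked, so the bound \<open>B\<close> has
  to hold for all of them. Folds whose step cost depends on the accumulator, such as repeated
  flagging, need their own induction.\<close>

lemma snd_fold_timed_le:
  assumes "\<And>x a. x \<in> set xs \<Longrightarrow> snd (f x a) \<le> B"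
  shows "snd (fold_timed f xs a) \<le> length xs * (B + 1) + 1"
  using assms
proof (induction xs arbitrary: a)
  case (Cons x xs)
  have "snd (f x a) \<le> B" "snd (fold_timed f xs (fst (f x a))) \<le> length xs * (B + 1) + 1"
    using Cons by auto
  then show ?case by simp
qed simp

lemma snd_length_timed_le: "snd (length_timed xs) \<le> 2 * length xs + 1"
proof -
  have "snd (length_timed xs) \<le> length xs * (1 + 1) + 1"
    unfolding length_timed_def by (rule snd_fold_timed_le) simp
  then show ?thesis by simp
qed

lemma snd_filter_has_dim_le: "snd (filter_timed (has_dim_timed k) S) \<le> 2 * length S + 1"
  using snd_filter_timed_le[of S "has_dim_timed k" 1] by simp

text \<open>Every vertex passed costs a membership test and a sign change. The scan ends after one
  more operation, either at the first vertex outside \<open>\<sigma>\<close> or at the end of the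
  list.\<close>

lemma snd_sign_timed_le: "snd (sign_timed \<sigma> vs s) \<le> 2 * length vs + 1"
  by (induction \<sigma> vs s rule: sign_timed.induct) auto

lemma snd_incidence_timed_le: "snd (incidence_timed \<sigma> \<tau> :: 'f::field timed) \<le> 2 * card \<tau> + 2"
  using snd_sign_timed_le[of \<sigma> "sorted_list_of_set \<tau>" "1 :: 'f"]
  by (simp add: incidence_timed_def)

lemma snd_flag_timed_le: "snd (flag_timed x I) \<le> 3 * length I + 1"
proof -
  have "snd (flag_timed x I) \<le> length I * (2 + 1) + 1"
    unfolding flag_timed_def by (rule snd_map_timed_le) (auto split: prod.splits)
  then show ?thesis by simp
qed

lemma snd_max_index_timed_le: "snd (max_index_timed I) \<le> 2 * length I + 1"
proof -
  have "snd (max_index_timed I) \<le> length I * (1 + 1) + 1"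
    unfolding max_index_timed_def by (rule snd_fold_timed_le) (auto split: prod.splits)
  then show ?thesis by simp
qed

text \<open>Two passes of cost at most \<open>2 * length D + 1\<close> each: one selects the entries
  containing \<open>x\<close>, the other takes the minimum of their degrees.\<close>

lemma snd_index_timed_le: "snd (index_timed D x) \<le> 4 * length D + 2"
proof -
  let ?F = "filter_timed (\<lambda>(\<sigma>, d). subset_timed x \<sigma>) D"
  have "snd ?F \<le> 2 * length D + 1"
    using snd_filter_timed_le[of D "\<lambda>(\<sigma>, d). subset_timed x \<sigma>" 1]
    by (fastforce simp: mult.commute split: prod.splits)
  moreover have "snd (case fst ?F of [] \<Rightarrow> tick 0
      | (\<sigma>, d) # D' \<Rightarrow> fold_timed (\<lambda>(\<sigma>', d') m. tick (min m d')) D' d) \<le> 2 * length D + 1"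
  proof (cases "fst ?F")
    case (Cons q D')
    obtain \<sigma> d where q: "q = (\<sigma>, d)"
      by (cases q)
    have "length (fst ?F) \<le> length D"
      unfolding fst_filter_timed by (rule length_filter_le)
    then have "length D' \<le> length D"
      by (simp only: Cons) simp
    moreover have "snd (fold_timed (\<lambda>(\<sigma>', d') m. tick (min m d')) D' d) \<le> 2 * length D' + 1"
      using snd_fold_timed_le[of D' "\<lambda>(\<sigma>', d') m. tick (min m d')" 1 d]
      by (simp add: case_prod_unfold)
    ultimately have "snd (fold_timed (\<lambda>(\<sigma>', d') m. tick (min m d')) D' d) \<le> 2 * length D + 1"
      by linarith
    then show ?thesis
      by (simp only: Cons q list.case prod.case)
  qed (simp only: list.case snd_tick)
  ultimately show ?thesis
    unfolding index_timed_def snd_bind_timed by linarith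
qed

lemma snd_degree_timed_le: "snd (degree_timed S \<sigma>) \<le> 3 * length S + 1"
proof -
  have "snd (degree_timed S \<sigma>) \<le> length S * (2 + 1) + 1"
    unfolding degree_timed_def by (rule snd_fold_timed_le) auto
  then show ?thesis by simp
qed

section \<open>Costs of initialization and of one passage, in terms of simplex counts\<close>

locale size_bounds =
  fixes S :: "'a::linorder set list" and k0 N p :: nat
  assumes length_le: "length S \<le> N"
    and low_le: "k \<le> k0 + 1 \<Longrightarrow> length (filter (\<lambda>\<sigma>. card \<sigma> = k + 1) S) \<le> p"
    and pos: "1 \<le> N" "1 \<le> p"
begin

text \<open>The common scale of all costs below: \<open>p ^ 3\<close> pays for a rank computation
  and \<open>p * N\<close> for the degrees of the \<open>(k0 + 1)\<close>-simplices.\<close>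

definition X :: nat where "X = p ^ 3 + p * N"

lemma monomials_le: "1 \<le> X" "N \<le> X" "p \<le> X" "p * p \<le> X" "p ^ 3 \<le> X" "p * N \<le> X"
proof -
  have "N \<le> p * N" "p \<le> p * N" "p * p \<le> p ^ 3"
    using pos by (simp_all add: power3_eq_cube)
  then show "N \<le> X" "p \<le> X" "p * p \<le> X" "1 \<le> X" "p ^ 3 \<le> X" "p * N \<le> X"
    using pos unfolding X_def by linarith+
qed

text \<open>Removing a vertex with its cofaces is a filter. The same \<open>N\<close> and
  \<open>p\<close> therefore serve every complex met by the algorithm, and the costs never have to
  be expressed in the sizes of the current complex.\<close>

lemma size_bounds_filter: "size_bounds (filter P S) k0 N p"
proof
  show "length (filter P S) \<le> N"
    using length_filter_le[of P S] length_le by linarith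
  show "length (filter (\<lambda>\<sigma>. card \<sigma> = k + 1) (filter P S)) \<le> p" if "k \<le> k0 + 1" for k
  proof -
    have "length (filter P (filter (\<lambda>\<sigma>. card \<sigma> = k + 1) S)) \<le> p"
      using length_filter_le[of P "filter (\<lambda>\<sigma>. card \<sigma> = k + 1) S"] low_le[OF that] by linarith
    then show ?thesis
      by (simp add: conj_commute)
  qed
qed (use pos in auto)

text \<open>There are at most \<open>p * p\<close> entries, and each costs only a constant depending
  on \<open>k0\<close>, because a column belongs to a simplex with at most \<open>k0 + 2\<close>
  vertices.\<close>

lemma snd_boundary_matrix_timed_le:
  assumes "k \<le> k0"
  shows "snd (boundary_matrix_timed S k :: 'f::field mat timed) \<le> (2 * k0 + 20) * X"
proof -
  let ?R = "filter (\<lambda>\<sigma>. card \<sigma> = k + 1) S" and ?C = "filter (\<lambda>\<sigma>. card \<sigma> = k + 1 + 1) S"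
  let ?col = "\<lambda>\<tau>. map_timed (\<lambda>\<sigma>. incidence_timed \<sigma> \<tau> :: 'f timed) ?R"
  have R: "length ?R \<le> p" and C: "length ?C \<le> p"
    using low_le[of k] low_le[of "k + 1"] assms by simp_all
  have "snd (?col \<tau>) \<le> p * (2 * k0 + 7) + 1" if "\<tau> \<in> set ?C" for \<tau>
  proof -
    \<comment> \<open>Membership in \<open>?C\<close> gives
      \<open>card \<tau> = k + 2 \<le> k0 + 2\<close>, and
      \<open>2 * (k0 + 2) + 2 = 2 * k0 + 6\<close>.\<close>
    have "snd (incidence_timed \<sigma> \<tau> :: 'f timed) \<le> 2 * k0 + 6" for \<sigma>
      using snd_incidence_timed_le[of \<sigma> \<tau>, where 'f = 'f] that assms by simp
    then have "snd (?col \<tau>) \<le> length ?R * (2 * k0 + 6 + 1) + 1"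
      by (intro snd_map_timed_le)
    also have "\<dots> \<le> p * (2 * k0 + 7) + 1"
      by (rule add_mono[OF mult_le_mono[OF R]]) simp_all
    finally show ?thesis .
  qed
  then have "snd (map_timed ?col ?C) \<le> length ?C * (p * (2 * k0 + 7) + 1 + 1) + 1"
    by (rule snd_map_timed_le)
  also have "\<dots> \<le> p * (p * (2 * k0 + 7) + 1 + 1) + 1"
    using C by (intro add_mono mult_le_mono) auto
  also have "\<dots> = (2 * k0 + 7) * (p * p) + 2 * p + 1"
    by (simp add: algebra_simps)
  finally have cols: "snd (map_timed ?col ?C) \<le> (2 * k0 + 7) * (p * p) + 2 * p + 1" .
  have "snd (boundary_matrix_timed S k :: 'f mat timed)
      = snd (filter_timed (has_dim_timed k) S) + snd (filter_timed (has_dim_timed (k + 1)) S)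
        + snd (length_timed ?R) + snd (map_timed ?col ?C) + 1"
    by (simp add: boundary_matrix_timed_def)
  also have "\<dots> \<le> (2 * N + 1) + (2 * N + 1) + (2 * p + 1)
      + ((2 * k0 + 7) * (p * p) + 2 * p + 1) + 1"
    using snd_filter_has_dim_le[of k S] snd_filter_has_dim_le[of "k + 1" S] length_le
      snd_length_timed_le[of ?R] R cols by linarith
  also have "\<dots> \<le> (2 * N + 1) + (2 * N + 1) + (2 * p + 1) + ((2 * k0 + 7) * X + 2 * p + 1) + 1"
    using mult_le_mono2[OF monomials_le(4), of "2 * k0 + 7"] by linarith
  \<comment> \<open>The terms outside the product add up to \<open>4 * N + 4 * p + 5\<close>, hence
    at most \<open>13 * X\<close>; this turns 7 into 20.\<close>
  also have "\<dots> \<le> (2 * k0 + 7) * X + 11 * X + 2 * X"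
    using monomials_le by linarith
  finally show ?thesis
    using monomials_le by (simp add: algebra_simps)
qed

lemma snd_boundary_rank_timed_le:
  fixes rc :: "'f::field mat \<Rightarrow> nat"
  assumes "k \<le> k0"
    and rc: "\<And>A. rc A \<le> c * (dim_row A * dim_col A * min (dim_row A) (dim_col A) + 1)"
  shows "snd (boundary_rank_timed rc S k) \<le> (2 * k0 + 20 + 2 * c) * X"
proof -
  let ?A = "fst (boundary_matrix_timed S k) :: 'f mat"
  have "dim_row ?A \<le> p" "dim_col ?A \<le> p"
    using low_le[of k] low_le[of "k + 1"] assms(1)
    by (simp_all add: boundary_matrix_timed_def mat_of_cols_list_def)
  then have "dim_row ?A * dim_col ?A * min (dim_row ?A) (dim_col ?A) \<le> p * p * p"
    by (intro mult_le_mono) auto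
  then have "rc ?A \<le> c * (p ^ 3 + 1)"
    using rc[of ?A] by (auto simp: power3_eq_cube intro: order_trans mult_le_mono2)
  \<comment> \<open>The additive 1 in the rank cost, which allows a constant cost even for empty
    matrices, is absorbed by a second \<open>X\<close>.\<close>
  also have "\<dots> \<le> c * (2 * X)"
    using monomials_le by (intro mult_le_mono2) linarith
  finally show ?thesis
    using snd_boundary_matrix_timed_le[OF assms(1), where 'f = 'f]
    by (simp add: boundary_rank_timed_def rank_timed_def algebra_simps)
qed

text \<open>A Betti number needs at most two boundary ranks, which doubles the previous constant;
  counting the \<open>k\<close>-simplices and the final subtraction fit into
  \<open>8 * X\<close>.\<close>

lemma snd_betti_timed_le:
  fixes rc :: "'f::field mat \<Rightarrow> nat"
  assumes "k \<le> k0"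
    and rc: "\<And>A. rc A \<le> c * (dim_row A * dim_col A * min (dim_row A) (dim_col A) + 1)"
  shows "snd (betti_timed rc S k) \<le> (4 * k0 + 48 + 4 * c) * X"
proof -
  let ?b = "case k of 0 \<Rightarrow> tick 0 | Suc j \<Rightarrow> boundary_rank_timed rc S j"
  have b: "snd ?b \<le> (2 * k0 + 20 + 2 * c) * X + 1"
  proof (cases k)
    case (Suc j)
    then show ?thesis
      using snd_boundary_rank_timed_le[OF _ rc, of j] assms(1) by simp
  qed simp
  have "length (filter (\<lambda>\<sigma>. card \<sigma> = k + 1) S) \<le> p"
    using low_le[of k] assms(1) by simp
  then have "snd (length_timed (filter (\<lambda>\<sigma>. card \<sigma> = k + 1) S)) \<le> 2 * p + 1"
    using snd_length_timed_le[of "filter (\<lambda>\<sigma>. card \<sigma> = k + 1) S"] by linarith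
  moreover have "snd (betti_timed rc S k) = snd (filter_timed (has_dim_timed k) S)
      + snd (length_timed (filter (\<lambda>\<sigma>. card \<sigma> = k + 1) S)) + snd ?b
      + snd (boundary_rank_timed rc S k) + 1"
    by (simp add: betti_timed_def)
  ultimately have "snd (betti_timed rc S k) \<le> (2 * N + 1) + (2 * p + 1)
      + ((2 * k0 + 20 + 2 * c) * X + 1) + (2 * k0 + 20 + 2 * c) * X + 1"
    using snd_filter_has_dim_le[of k S] b snd_boundary_rank_timed_le[OF assms(1) rc] length_le
    by linarith
  also have "\<dots> \<le> 8 * X + 2 * ((2 * k0 + 20 + 2 * c) * X)"
    using monomials_le by linarith
  finally show ?thesis
    by (simp add: algebra_simps)
qed

lemma snd_betti_list_timed_le:
  fixes rc :: "'f::field mat \<Rightarrow> nat"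
  assumes rc: "\<And>A. rc A \<le> c * (dim_row A * dim_col A * min (dim_row A) (dim_col A) + 1)"
  shows "snd (betti_list_timed rc k0 S) \<le> ((k0 + 1) * (4 * k0 + 49 + 4 * c) + 1) * X"
proof -
  have "snd (betti_timed rc S k) \<le> (4 * k0 + 48 + 4 * c) * X" if "k \<in> set [0..<k0 + 1]" for k
    using that by (intro snd_betti_timed_le[OF _ rc]) auto
  then have "snd (betti_list_timed rc k0 S)
      \<le> length [0..<k0 + 1] * ((4 * k0 + 48 + 4 * c) * X + 1) + 1"
    unfolding betti_list_timed_def by (rule snd_map_timed_le)
  also have "\<dots> \<le> (k0 + 1) * ((4 * k0 + 48 + 4 * c) * X + X) + X"
    using monomials_le by (intro add_mono mult_le_mono) auto
  also have "\<dots> = ((k0 + 1) * (4 * k0 + 49 + 4 * c) + 1) * X"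
    by (simp add: algebra_simps)
  finally show ?thesis .
qed

lemma length_degrees_timed_le: "length (fst (degrees_timed k0 S)) \<le> p"
  using low_le[of "k0 + 1"] by (simp add: degrees_timed_def)

text \<open>Each of the at most \<open>p\<close> simplices of dimension \<open>k0 + 1\<close> is
  tested for inclusion in all of the at most \<open>N\<close> simplices.\<close>

lemma snd_degrees_timed_le: "snd (degrees_timed k0 S) \<le> 10 * X"
proof -
  let ?C = "filter (\<lambda>\<sigma>. card \<sigma> = k0 + 1 + 1) S"
  have C: "length ?C \<le> p"
    using low_le[of "k0 + 1"] by simp
  have "snd (do { d \<leftarrow> degree_timed S \<sigma>; tick (\<sigma>, d) }) \<le> 3 * N + 2" for \<sigma>
    using snd_degree_timed_le[of S \<sigma>] length_le by simp
  then have "snd (map_timed (\<lambda>\<sigma>. do { d \<leftarrow> degree_timed S \<sigma>; tick (\<sigma>, d) }) ?C)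
      \<le> length ?C * (3 * N + 2 + 1) + 1"
    by (rule snd_map_timed_le)
  also have "\<dots> \<le> p * (3 * N + 2 + 1) + 1"
    using C by (intro add_mono mult_le_mono) auto
  also have "\<dots> = 3 * (p * N) + 3 * p + 1"
    by (simp add: algebra_simps)
  finally have "snd (degrees_timed k0 S) \<le> (2 * N + 1) + (3 * (p * N) + 3 * p + 1)"
    using snd_filter_has_dim_le[of "k0 + 1" S] length_le
    by (simp add: degrees_timed_def)
  then show ?thesis
    using monomials_le by linarith
qed

text \<open>Serves both the initial index computation and the recomputation after a removal. The
  slack of 2 over the cost of \<open>index_timed\<close> covers the test for the flag
  \<open>- 1\<close> and the writing of the entry.\<close>

lemma snd_map_index_timed_le:
  assumes "length I \<le> p" "length D \<le> p"
    and "\<And>y. y \<in> set I \<Longrightarrow> snd (f y) \<le> 4 * length D + 4"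
  shows "snd (map_timed f I) \<le> 10 * X"
proof -
  have "snd (map_timed f I) \<le> length I * (4 * length D + 4 + 1) + 1"
    using assms(3) by (rule snd_map_timed_le)
  also have "\<dots> \<le> p * (4 * p + 4 + 1) + 1"
    using assms(1,2) by (intro add_mono mult_le_mono) auto
  also have "\<dots> = 4 * (p * p) + 5 * p + 1"
    by (simp add: algebra_simps)
  finally show ?thesis
    using monomials_le by linarith
qed

lemma snd_init_timed_le:
  fixes rc :: "'f::field mat \<Rightarrow> nat"
  assumes rc: "\<And>A. rc A \<le> c * (dim_row A * dim_col A * min (dim_row A) (dim_col A) + 1)"
    and "length L \<le> p"
  shows "snd (init_timed rc k0 S L) \<le> ((k0 + 1) * (4 * k0 + 49 + 4 * c) + 33) * X"
proof -
  define D where "D = fst (degrees_timed k0 S)"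
  let ?V = "filter (\<lambda>\<sigma>. card \<sigma> = 0 + 1) S"
  define M where "M = map_timed (\<lambda>x. do { i \<leftarrow> index_timed D x; tick (x, int i) }) ?V"
  have V: "length ?V \<le> p"
    using low_le[of 0] by simp
  have D: "length D \<le> p"
    unfolding D_def by (rule length_degrees_timed_le)
  have M: "snd M \<le> 10 * X"
    unfolding M_def
  proof (rule snd_map_index_timed_le[OF V D])
    show "snd (do { i \<leftarrow> index_timed D x; tick (x, int i) }) \<le> 4 * length D + 4" for x
      using snd_index_timed_le[of D x] by simp
  qed
  \<comment> \<open>Flagging keeps the length of the table, so all passes over it have the same
    bound.\<close>
  have flags: "snd (fold_timed flag_timed L I) \<le> length L * (3 * length I + 2) + 1"
    for I :: "('a set \<times> int) list"
  proof (induction L arbitrary: I)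
    case (Cons x L)
    have "length (fst (flag_timed x I)) = length I"
      by (simp add: fst_flag_timed)
    then show ?case
      using Cons[of "fst (flag_timed x I)"] snd_flag_timed_le[of x I] by simp
  qed simp
  have "length (fst M) = length ?V"
    by (simp add: M_def)
  then have "snd (fold_timed flag_timed L (fst M)) \<le> length L * (3 * length ?V + 2) + 1"
    using flags[of "fst M"] by simp
  also have "\<dots> \<le> p * (3 * p + 2) + 1"
    using assms(2) V by (intro add_mono mult_le_mono) auto
  also have "\<dots> = 3 * (p * p) + 2 * p + 1"
    by (simp add: algebra_simps)
  finally have F: "snd (fold_timed flag_timed L (fst M)) \<le> 6 * X"
    using monomials_le by linarith
  have "snd (init_timed rc k0 S L) = snd (betti_list_timed rc k0 S) + snd (degrees_timed k0 S)
      + snd (filter_timed (has_dim_timed 0) S) + snd M + snd (fold_timed flag_timed L (fst M)) + 1"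
    by (simp add: init_timed_def M_def D_def)
  also have "\<dots> \<le> ((k0 + 1) * (4 * k0 + 49 + 4 * c) + 1) * X + 10 * X + (2 * N + 1) + 10 * X + 6 * X + 1"
    using snd_betti_list_timed_le[OF rc] snd_degrees_timed_le snd_filter_has_dim_le[of 0 S] length_le M F
    by linarith
  also have "\<dots> \<le> ((k0 + 1) * (4 * k0 + 49 + 4 * c) + 1) * X + 32 * X"
    using monomials_le by linarith
  also have "\<dots> = ((k0 + 1) * (4 * k0 + 49 + 4 * c) + 33) * X"
    by (simp add: algebra_simps)
  finally show ?thesis .
qed

lemma snd_step_timed_le:
  fixes rc :: "'f::field mat \<Rightarrow> nat"
  assumes rc: "\<And>A. rc A \<le> c * (dim_row A * dim_col A * min (dim_row A) (dim_col A) + 1)"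
    and "length b \<le> k0 + 1" "length I \<le> p"
  shows "snd (step_timed rc k0 b S I x) \<le> ((k0 + 1) * (4 * k0 + 51 + 4 * c) + 31) * X"
proof -
  let ?T = "filter (\<lambda>\<sigma>. \<not> x \<subseteq> \<sigma>) S"
  interpret T: size_bounds ?T k0 N p
    by (rule size_bounds_filter)
  define D where "D = fst (degrees_timed k0 ?T)"
  define F where "F = filter_timed (\<lambda>\<sigma>. do { c \<leftarrow> subset_timed x \<sigma>; tick (\<not> c) }) S"
  define b' where "b' = fst (betti_list_timed rc k0 ?T)"
  define Z where "Z = fold_timed (\<lambda>(u, v) e. tick (e \<or> u \<noteq> v)) (zip b b') False"
  define J where "J = filter_timed (\<lambda>(y, i). tick (y \<noteq> x)) I"
  define M where "M = map_timed (\<lambda>(y, i). do {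
      f \<leftarrow> tick (i = - 1);
      if f then tick (y, i) else do { j \<leftarrow> index_timed D y; tick (y, int j) } }) (fst J)"
  have D: "length D \<le> p"
    unfolding D_def by (rule T.length_degrees_timed_le)
  have fst_F: "fst F = ?T"
    by (simp add: F_def)
  have "snd F \<le> length S * (2 + 1) + 1"
    unfolding F_def by (rule snd_filter_timed_le) simp
  then have F: "snd F \<le> 3 * N + 1"
    using length_le by simp
  have "snd Z \<le> length (zip b b') * (1 + 1) + 1"
    unfolding Z_def by (rule snd_fold_timed_le) (auto split: prod.splits)
  then have Z: "snd Z \<le> 2 * (k0 + 1) + 1"
    using assms(2) by simp
  have "snd J \<le> length I * (1 + 1) + 1"
    unfolding J_def by (rule snd_filter_timed_le) (auto split: prod.splits)
  then have J: "snd J \<le> 2 * p + 1"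
    using assms(3) by simp
  have "length (fst J) \<le> p"
    using assms(3) unfolding J_def fst_filter_timed by (rule order_trans[OF length_filter_le])
  then have M: "snd M \<le> 10 * X"
    unfolding M_def
  proof (rule snd_map_index_timed_le[OF _ D])
    show "snd (case q of (y, i) \<Rightarrow> do {
        f \<leftarrow> tick (i = - 1);
        if f then tick (y, i) else do { j \<leftarrow> index_timed D y; tick (y, int j) } })
      \<le> 4 * length D + 4" for q :: "'a set \<times> int"
      using snd_index_timed_le[of D "fst q"] by (cases q) simp
  qed
  have fl: "snd (flag_timed x I) \<le> 3 * p + 1"
    using snd_flag_timed_le[of x I] assms(3) by linarith
  have "snd (step_timed rc k0 b S I x) = snd F + snd (betti_list_timed rc k0 ?T) + snd Z
      + (if fst Z then snd (flag_timed x I) + 1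
         else snd (degrees_timed k0 ?T) + snd J + snd M + 1)"
    unfolding step_timed_def snd_bind_timed F_def[symmetric] fst_F b'_def[symmetric] Z_def[symmetric]
      D_def[symmetric] J_def[symmetric] M_def[symmetric] if_distrib[of snd] snd_tick
    by simp
  \<comment> \<open>One expression covers both branches: \<open>3 * p + 1\<close> dominates flagging
    when the removal is cancelled and also the deletion of the row of \<open>x\<close>
    otherwise.\<close>
  also have "\<dots> \<le> (3 * N + 1) + ((k0 + 1) * (4 * k0 + 49 + 4 * c) + 1) * X + (2 * (k0 + 1) + 1)
      + (10 * X + (3 * p + 1) + 10 * X + 1)"
    using F T.snd_betti_list_timed_le[OF rc] Z fl T.snd_degrees_timed_le J M by auto
  \<comment> \<open>Comparing the two lists of Betti numbers costs \<open>2 * (k0 + 1)\<close> up to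
    a constant; scaling this by \<open>X\<close> raises 49 to 51.\<close>
  also have "\<dots> \<le> (3 * N + 1) + ((k0 + 1) * (4 * k0 + 49 + 4 * c) + 1) * X + (2 * ((k0 + 1) * X) + 1)
      + (10 * X + (3 * p + 1) + 10 * X + 1)"
    using mult_le_mono2[OF monomials_le(1), of "k0 + 1"] by linarith
  also have "\<dots> \<le> ((k0 + 1) * (4 * k0 + 49 + 4 * c) + 1) * X + 2 * ((k0 + 1) * X) + 30 * X"
    using monomials_le pos by linarith
  also have "\<dots> \<le> ((k0 + 1) * (4 * k0 + 51 + 4 * c) + 31) * X"
    by (simp add: algebra_simps)
  finally show ?thesis .
qed

end

section \<open>Worst-case cost of the loop and of the whole algorithm, over all random draws\<close>

lemma reduction_loop_time_le:
  fixes rc :: "'f::field mat \<Rightarrow> nat"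
  assumes rc: "\<And>A. rc A \<le> c * (dim_row A * dim_col A * min (dim_row A) (dim_col A) + 1)"
    and "size_bounds S k0 N p" "length b \<le> k0 + 1" "length I \<le> p"
    and "(out, t) \<in> set_pmf (reduction_loop rc k0 b S I)"
  shows "t \<le> length (filter (\<lambda>(y, i). i \<noteq> - 1) I)
      * (((k0 + 1) * (4 * k0 + 51 + 4 * c) + 39) * size_bounds.X N p) + 4 * size_bounds.X N p"
  using assms(2,4,5)
\<comment> \<open>The measure is the number of entries not flagged \<open>- 1\<close>, which also
  proves termination. Testing and drawing cost at most \<open>4 * p + 4 \<le> 8 * X\<close> per
  passage, so 39 = 31 + 8; the last test alone fits into \<open>4 * X\<close>.\<close>
proof (induction "length (filter (\<lambda>(y, i). i \<noteq> - 1) I)" arbitrary: S I out t rule: less_induct)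
  case less
  interpret size_bounds S k0 N p
    by (rule less.prems(1))
  let ?n = "\<lambda>I :: ('a set \<times> int) list. length (filter (\<lambda>(y, i). i \<noteq> - 1) I)"
  let ?E = "((k0 + 1) * (4 * k0 + 51 + 4 * c) + 39) * X"
  define imax where "imax = fst (max_index_timed I)"
  define F where "F = filter_timed (\<lambda>(y, i). tick (i = imax)) I"
  have max: "snd (max_index_timed I) \<le> 2 * p + 1"
    using snd_max_index_timed_le[of I] less.prems(2) by linarith
  show ?case
  proof (cases "imax \<le> int (k0 + 1)")
    case True
    then have "t = snd (max_index_timed I) + 1"
      using less.prems(3) by (subst (asm) reduction_loop.simps) (simp add: imax_def case_prod_unfold)
    then have "t \<le> 4 * X"
      using max monomials_le by linarith
    then show ?thesis
      by simp
  next
    case False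
    have "snd F \<le> length I * (1 + 1) + 1"
      unfolding F_def by (rule snd_filter_timed_le) (auto split: prod.splits)
    then have F: "snd F \<le> 2 * p + 1"
      using less.prems(2) by simp
    have fst_F: "fst F = filter (\<lambda>(y, i). i = imax) I"
      by (simp add: F_def case_prod_unfold)
    \<comment> \<open>Since the loop continues, \<open>imax\<close> exceeds \<open>k0 + 1\<close>,
      so it is not the default \<open>- 1\<close> and is attained in the table. The set drawn from
      is thus nonempty, as is required for the support of \<open>pmf_of_set\<close>.\<close>
    have "imax \<in> insert (- 1) (snd ` set I)"
      unfolding imax_def fst_max_index_timed by (intro Max_in) auto
    then obtain y where "(y, imax) \<in> set I"
      using False by auto
    then have "(y, imax) \<in> set (fst F)"
      by (simp add: fst_F)
    then have "fst ` set (fst F) \<noteq> {}"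
      by auto
    then have "set_pmf (pmf_of_set (fst ` set (fst F))) = fst ` set (fst F)"
      by (intro set_pmf_of_set) auto
    moreover have "(out, t) \<in> set_pmf (bind_pmf (pmf_of_set (fst ` set (fst F))) (\<lambda>x.
        map_pmf (\<lambda>(out, u). (out, snd (max_index_timed I) + 1 + snd F + 1 + snd (step_timed rc k0 b S I x) + u))
          (reduction_loop rc k0 b (fst (fst (step_timed rc k0 b S I x))) (snd (fst (step_timed rc k0 b S I x))))))"
      using less.prems(3) False
      by (subst (asm) reduction_loop.simps)
        (simp add: imax_def[symmetric] F_def case_prod_unfold del: reduction_loop.simps)
    ultimately obtain x u where x: "x \<in> fst ` set (fst F)"
      and u: "(out, u) \<in> set_pmf (reduction_loop rc k0 b
          (fst (fst (step_timed rc k0 b S I x))) (snd (fst (step_timed rc k0 b S I x))))"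
      and t: "t = snd (max_index_timed I) + 1 + snd F + 1 + snd (step_timed rc k0 b S I x) + u"
      by (auto simp del: reduction_loop.simps)
    define S' I' where "S' = fst (fst (step_timed rc k0 b S I x))"
      and "I' = snd (fst (step_timed rc k0 b S I x))"
    have "(x, imax) \<in> set I"
      using x by (auto simp: fst_F)
    then have dec: "?n I' < ?n I"
      unfolding I'_def by (rule step_timed_decreasing) (use False in simp)
    \<comment> \<open>The removal is either cancelled or performed; the size bounds survive in both
      cases.\<close>
    have "S' = S \<or> S' = filter (\<lambda>\<sigma>. \<not> x \<subseteq> \<sigma>) S"
      by (simp add: S'_def step_timed_def)
    then have S': "size_bounds S' k0 N p"
      using less.prems(1) size_bounds_filter by auto
    have "length I' \<le> length I"
      using snd_fst_step_timed[of rc k0 b S I x] unfolding I'_def by (auto split: if_splits)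
    then have "u \<le> ?n I' * ?E + 4 * X"
      using less.hyps[OF dec S' _ u[folded S'_def I'_def]] less.prems(2) by simp
    moreover have "snd (step_timed rc k0 b S I x) \<le> ((k0 + 1) * (4 * k0 + 51 + 4 * c) + 31) * X"
      by (rule snd_step_timed_le[OF rc assms(3) less.prems(2)])
    ultimately have "t \<le> (8 * X + ((k0 + 1) * (4 * k0 + 51 + 4 * c) + 31) * X) + (?n I' * ?E + 4 * X)"
      using t max F monomials_le by linarith
    also have "\<dots> = Suc (?n I') * ?E + 4 * X"
      by (simp add: algebra_simps)
    also have "\<dots> \<le> ?n I * ?E + 4 * X"
      using dec by (intro add_mono mult_le_mono) auto
    finally show ?thesis .
  qed
qed

text \<open>The initial table has one row per vertex, so there are at most \<open>n\<close> passages
  of cost \<open>O(X)\<close>; the single initialization is of the same order as one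
  passage.\<close>

lemma reduction_time_le:
  fixes rc :: "'f::field mat \<Rightarrow> nat"
  assumes rc: "\<And>A. rc A \<le> c * (dim_row A * dim_col A * min (dim_row A) (dim_col A) + 1)"
    and S: "size_bounds S k0 N p" and V: "length (filter (\<lambda>\<sigma>. card \<sigma> = 1) S) = n" "1 \<le> n"
    and L: "length L \<le> n"
    and t: "(out, t) \<in> set_pmf (reduction rc k0 S L)"
  shows "t \<le> (2 * (k0 + 1) * (4 * k0 + 51 + 4 * c) + 76) * (n * (p ^ 3 + p * N))"
proof -
  interpret size_bounds S k0 N p
    by (rule S)
  let ?A = "(k0 + 1) * (4 * k0 + 51 + 4 * c)"
  define b I where "b = fst (fst (init_timed rc k0 S L))" and "I = snd (fst (init_timed rc k0 S L))"
  obtain u where u: "(out, u) \<in> set_pmf (reduction_loop rc k0 b S I)"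
    and t: "t = snd (init_timed rc k0 S L) + u"
    using t by (auto simp: reduction_def case_prod_unfold b_def I_def simp del: reduction_loop.simps)
  have n: "n \<le> p"
    using low_le[of 0] V by simp
  have b: "length b \<le> k0 + 1"
    by (simp add: b_def init_timed_def betti_list_timed_def)
  have "length (fold (\<lambda>x a. fst (flag_timed x a)) L J) = length J" for J :: "('a set \<times> int) list"
    by (induction L arbitrary: J) (simp_all add: fst_flag_timed)
  then have I: "length I = n"
    using V by (simp add: I_def init_timed_def)
  have "u \<le> length (filter (\<lambda>(y, i). i \<noteq> - 1) I) * ((?A + 39) * X) + 4 * X"
    using reduction_loop_time_le[OF rc S b _ u] I n by simp
  also have "\<dots> \<le> n * ((?A + 39) * X) + 4 * X"
    using length_filter_le[of "\<lambda>(y, i). i \<noteq> - 1" I] I by (intro add_mono mult_le_mono) auto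
  finally have "u \<le> (?A + 39) * (n * X) + 4 * X"
    by (simp only: mult.left_commute)
  moreover have "snd (init_timed rc k0 S L) \<le> (?A + 33) * X"
  proof -
    have "snd (init_timed rc k0 S L) \<le> ((k0 + 1) * (4 * k0 + 49 + 4 * c) + 33) * X"
      using L n by (intro snd_init_timed_le[OF rc]) simp
    also have "\<dots> \<le> (?A + 33) * X"
      by (intro mult_le_mono1 add_mono mult_le_mono2) simp_all
    finally show ?thesis .
  qed
  ultimately have "t \<le> (?A + 33) * X + ((?A + 39) * (n * X) + 4 * X)"
    using t by linarith
  \<comment> \<open>As \<open>1 \<le> n\<close>, the one-time costs are absorbed too, and 33 + 39 +
    4 = 76.\<close>
  also have "\<dots> \<le> (?A + 33) * (n * X) + ((?A + 39) * (n * X) + 4 * (n * X))"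
    using V(2) by (intro add_mono mult_le_mono2) simp_all
  also have "\<dots> = (2 * (k0 + 1) * (4 * k0 + 51 + 4 * c) + 76) * (n * X)"
    by (simp add: algebra_simps)
  finally show ?thesis
    by (simp add: X_def)
qed

section \<open>Counting simplices by vertices, and the asymptotic bound\<close>

lemma card_simplices_le_binomial:
  assumes "abstract_simplicial_complex S"
  shows "card (simplices S k) \<le> card (simplices S 0) choose (k + 1)"
proof -
  \<comment> \<open>The \<open>0\<close>-simplices are singletons; \<open>?V\<close> consists of the
    underlying points. By closure under nonempty subsets every \<open>k\<close>-simplex is a
    \<open>(k + 1)\<close>-element subset of \<open>?V\<close>.\<close>
  let ?V = "{v. {v} \<in> S}"
  have vertices: "simplices S 0 = (\<lambda>v. {v}) ` ?V"
    by (auto simp: simplices_def card_1_singleton_iff)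
  have "finite ((\<lambda>v. {v}) ` ?V)"
    using finite_simplices[OF assms, of 0] unfolding vertices .
  then have V: "finite ?V"
    by (rule finite_imageD) simp
  have "card (simplices S 0) = card ?V"
    unfolding vertices by (rule card_image) simp
  moreover have "simplices S k \<subseteq> {\<sigma>. \<sigma> \<subseteq> ?V \<and> card \<sigma> = k + 1}"
    using assms by (auto simp: simplices_def abstract_simplicial_complex_def)
  then have "card (simplices S k) \<le> card {\<sigma>. \<sigma> \<subseteq> ?V \<and> card \<sigma> = k + 1}"
    using V by (intro card_mono) auto
  ultimately show ?thesis
    using V by (simp add: n_subsets)
qed

lemma binomial_le_power_nat: "n choose k \<le> n ^ k" for n k :: nat
  by (cases "k \<le> n") (simp_all add: binomial_le_pow binomial_eq_0)

text \<open>The \<open>k0 + 2\<close> lowest dimensions contribute at most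
  \<open>n ^ (k0 + 2)\<close> each, and the higher ones keep their binomial coefficients. For
  \<open>K < k0 + 2\<close> the last sum is empty.\<close>

lemma card_complex_le:
  assumes S: "abstract_simplicial_complex S" and n: "card (simplices S 0) = n" "1 \<le> n"
    and K: "\<And>k. k > K \<Longrightarrow> simplices S k = {}"
  shows "card S \<le> (k0 + 2) * n ^ (k0 + 2) + (\<Sum>k = k0 + 2..K. n choose (k + 1))"
proof -
  have "S \<subseteq> (\<Union>k\<in>{..<k0 + 2} \<union> {k0 + 2..K}. simplices S k)"
  proof
    fix \<sigma> assume "\<sigma> \<in> S"
    then have "\<sigma> \<in> simplices S (card \<sigma> - 1)"
      using simplicial_complex_card[OF S \<open>\<sigma> \<in> S\<close>] by (simp add: simplices_def)
    moreover from this have "card \<sigma> - 1 \<le> K"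
      using K[of "card \<sigma> - 1"] by (cases "card \<sigma> - 1 \<le> K") auto
    ultimately show "\<sigma> \<in> (\<Union>k\<in>{..<k0 + 2} \<union> {k0 + 2..K}. simplices S k)"
      by force
  qed
  then have "card S \<le> card (\<Union>k\<in>{..<k0 + 2} \<union> {k0 + 2..K}. simplices S k)"
    using finite_simplices[OF S] by (intro card_mono) auto
  also have "\<dots> \<le> (\<Sum>k\<in>{..<k0 + 2} \<union> {k0 + 2..K}. card (simplices S k))"
    by (rule card_UN_le) simp
  also have "\<dots> \<le> (\<Sum>k\<in>{..<k0 + 2} \<union> {k0 + 2..K}. n choose (k + 1))"
    using card_simplices_le_binomial[OF S] n by (intro sum_mono) simp
  also have "\<dots> = (\<Sum>k<k0 + 2. n choose (k + 1)) + (\<Sum>k = k0 + 2..K. n choose (k + 1))"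
    by (rule sum.union_disjoint) auto
  also have "(\<Sum>k<k0 + 2. n choose (k + 1)) \<le> (\<Sum>k<k0 + 2. n ^ (k0 + 2))"
  proof (rule sum_mono)
    fix k assume "k \<in> {..<k0 + 2}"
    then have "n ^ (k + 1) \<le> n ^ (k0 + 2)"
      using n(2) by (intro power_increasing) auto
    then show "n choose (k + 1) \<le> n ^ (k0 + 2)"
      using binomial_le_power_nat[of n "k + 1"] by linarith
  qed
  finally show ?thesis
    by simp
qed

lemma size_bounds_complex:
  fixes S :: "'a::linorder set list"
  assumes S: "abstract_simplicial_complex (set S)" "distinct S"
    and n: "card (simplices (set S) 0) = n" "1 \<le> n"
    and K: "\<And>k. k > K \<Longrightarrow> simplices (set S) k = {}"
  shows "size_bounds S k0 ((k0 + 2) * n ^ (k0 + 2) + (\<Sum>k = k0 + 2..K. n choose (k + 1))) (n ^ (k0 + 2))"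
proof
  show "length S \<le> (k0 + 2) * n ^ (k0 + 2) + (\<Sum>k = k0 + 2..K. n choose (k + 1))"
    using card_complex_le[OF S(1) n K] distinct_card[OF S(2)] by simp
  show "length (filter (\<lambda>\<sigma>. card \<sigma> = k + 1) S) \<le> n ^ (k0 + 2)" if "k \<le> k0 + 1" for k
  proof -
    have "length (filter (\<lambda>\<sigma>. card \<sigma> = k + 1) S) = card (simplices (set S) k)"
      using distinct_card[of "filter (\<lambda>\<sigma>. card \<sigma> = k + 1) S"] S(2)
      by (simp only: simplices_filter distinct_filter)
    also have "\<dots> \<le> n ^ (k + 1)"
      using card_simplices_le_binomial[OF S(1), of k] binomial_le_power_nat[of n "k + 1"] n(1)
      by simp
    also have "\<dots> \<le> n ^ (k0 + 2)"
      using n(2) that by (intro power_increasing) auto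
    finally show ?thesis .
  qed
  show "1 \<le> n ^ (k0 + 2)"
    using n(2) by (rule one_le_power)
  then show "1 \<le> (k0 + 2) * n ^ (k0 + 2) + (\<Sum>k = k0 + 2..K. n choose (k + 1))"
    by (simp add: trans_le_add1)
qed

text \<open>The worst case is expressed by ranging over every \<open>(out, t)\<close> in the support
  of the random output. The constant found depends only on \<open>k0\<close> and \<open>c\<close>,
  and the estimate already holds from \<open>s0 = 1\<close> on.\<close>

theorem corollary7:
  fixes k0 :: nat and rc :: "'f::field mat \<Rightarrow> nat" and c :: nat
  assumes rank_cost:
    "\<And>A. rc A \<le> c * (dim_row A * dim_col A * min (dim_row A) (dim_col A) + 1)"
  shows "\<exists>C::real. \<forall>\<^sub>F s0 in sequentially.
    \<forall>(S :: 'a::linorder set list) L K out t.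
      abstract_simplicial_complex (set S) \<and> distinct S \<and>
      card (simplices (set S) 0) = s0 \<and>
      simplices (set S) K \<noteq> {} \<and> (\<forall>k>K. simplices (set S) k = {}) \<and>
      set L \<subseteq> simplices (set S) 0 \<and> distinct L \<and>
      (out, t) \<in> set_pmf (reduction rc k0 S L) \<longrightarrow>
      real t \<le> C * (real s0 ^ (3 * k0 + 7)
        + real s0 ^ (k0 + 3) * (\<Sum>k = k0 + 2..K. real (s0 choose (k + 1))))"
proof -
  define E where "E = 2 * (k0 + 1) * (4 * k0 + 51 + 4 * c) + 76"
  have bound: "real t \<le> real (E * (k0 + 3)) * (real n ^ (3 * k0 + 7)
      + real n ^ (k0 + 3) * (\<Sum>k = k0 + 2..K. real (n choose (k + 1))))"
    if n: "1 \<le> n" "card (simplices (set S) 0) = n"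
      and S: "abstract_simplicial_complex (set S)" "distinct S"
      and K: "\<forall>k>K. simplices (set S) k = {}"
      and L: "set L \<subseteq> simplices (set S) 0" "distinct L"
      and t: "(out, t) \<in> set_pmf (reduction rc k0 S L)"
    for n K out t and S L :: "'a set list"
  proof -
    define p where "p = n ^ (k0 + 2)"
    define s where "s = (\<Sum>k = k0 + 2..K. n choose (k + 1))"
    have "length L \<le> n"
      using card_mono[OF finite_simplices[OF S(1)] L(1)] distinct_card[OF L(2)] n(2) by simp
    moreover have "length (filter (\<lambda>\<sigma>. card \<sigma> = 1) S) = n"
      using distinct_card[of "filter (\<lambda>\<sigma>. card \<sigma> = 0 + 1) S"] S(2) n(2)
      by (simp only: simplices_filter distinct_filter) simp
    moreover have "size_bounds S k0 ((k0 + 2) * p + s) p"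
      unfolding p_def s_def using K by (intro size_bounds_complex[OF S n(2,1)]) auto
    ultimately have "t \<le> E * (n * (p ^ 3 + p * ((k0 + 2) * p + s)))"
      unfolding E_def using t n(1) by (intro reduction_time_le[OF rank_cost])
    also have "\<dots> \<le> E * ((k0 + 3) * (n * p ^ 3 + n * p * s))"
    proof (intro mult_le_mono2)
      have "1 \<le> p"
        unfolding p_def using n(1) by (rule one_le_power)
      then have "p * p \<le> p ^ 3"
        by (simp add: power3_eq_cube)
      \<comment> \<open>The low-dimensional part of \<open>N\<close> disappears into
        \<open>p ^ 3\<close>; the generous factor of \<open>p * s\<close> makes
        \<open>k0 + 3\<close> a common factor once another \<open>p ^ 3\<close> is added.\<close>
      then have "(k0 + 2) * (p * p) + p * s \<le> (k0 + 2) * p ^ 3 + (k0 + 3) * (p * s)"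
        by (intro add_mono mult_le_mono2) simp_all
      then have "p ^ 3 + p * ((k0 + 2) * p + s) \<le> (k0 + 3) * (p ^ 3 + p * s)"
        by (simp add: algebra_simps)
      then have "n * (p ^ 3 + p * ((k0 + 2) * p + s)) \<le> n * ((k0 + 3) * (p ^ 3 + p * s))"
        by (rule mult_le_mono2)
      then show "n * (p ^ 3 + p * ((k0 + 2) * p + s)) \<le> (k0 + 3) * (n * p ^ 3 + n * p * s)"
        by (simp add: algebra_simps)
    qed
    \<comment> \<open>Here the exponents arise: the factor \<open>n\<close> counts passages, and
      \<open>p = n ^ (k0 + 2)\<close> enters cubed through the ranks and once through the
      degrees.\<close>
    also have "n * p ^ 3 = n ^ (1 + (k0 + 2) * 3)"
      by (simp only: p_def power_add power_mult power_one_right)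
    also have "1 + (k0 + 2) * 3 = 3 * k0 + 7"
      by simp
    also have "n * p = n ^ (k0 + 3)"
      by (simp add: p_def eval_nat_numeral)
    finally have "t \<le> E * (k0 + 3) * (n ^ (3 * k0 + 7) + n ^ (k0 + 3) * s)"
      by (simp only: mult.assoc)
    then have "real t \<le> real (E * (k0 + 3) * (n ^ (3 * k0 + 7) + n ^ (k0 + 3) * s))"
      by (rule of_nat_mono)
    then show ?thesis
      by (simp only: s_def of_nat_mult of_nat_add of_nat_power of_nat_sum)
  qed
  show ?thesis
    by (intro exI[of _ "real (E * (k0 + 3))"] eventually_sequentiallyI[of 1] allI impI, elim conjE,
      rule bound)
qed

end
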